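(* There exists a universal constant $c>0$ such that the following holds. Fix an integer $r\ge 2$ and an $r$-colouring of the edges of $K_n$ (with colours in $[r]$). Then, for every tree $T$ on $n$ vertices with maximum degree $\Delta$, there exist a colour $i\in [r]$ and a copy of $T$ in $K_n$ in which the number of edges in colour $i$ is at least $$\frac{n-1}{r}+\frac{c}{r^2}(n-1-\Delta).$$
   Context: $[r]=\{1,\dots,r\}$. An $r$-colouring of the edges of a graph is an arbitrary map from its edge set to $[r]$. A copy of $T$ in $K_n$ is a subgraph of $K_n$ isomorphic to $T$. The constant $c$ does not depend on $r$, $n$, $T$, $\Delta$ or the colouring. *)

theory Defs
  imports Complex_Main "HOL-Library.FuncSet" "HOL-Library.Ramsey"
begin

(* Undirected simple graphs: an edge is a 2-element set of vertices, and
   [V]\<^bsup>2\<^esup> is the set of all 2-element subsets of V (nsets, from HOL-Library.Ramsey). *)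

record 'a ugraph =
  vertices :: "'a set"
  edges :: "'a set set"

definition simple_graph :: "'a ugraph \<Rightarrow> bool" where
  "simple_graph G \<longleftrightarrow> finite (vertices G) \<and> edges G \<subseteq> [vertices G]\<^bsup>2\<^esup>"

definition complete_graph :: "nat \<Rightarrow> nat ugraph" where
  "complete_graph n = \<lparr> vertices = {1..n}, edges = [{1..n}]\<^bsup>2\<^esup> \<rparr>"

definition connected_graph :: "'a ugraph \<Rightarrow> bool" where
  "connected_graph G \<longleftrightarrow> vertices G \<noteq> {} \<and>
     (\<forall>u \<in> vertices G. \<forall>v \<in> vertices G. (u, v) \<in> {(x, y). {x, y} \<in> edges G}\<^sup>*)"

(* A cycle is given by the list of its vertices in cyclic order, without
   repeating the first vertex at the end. *)
definition graph_cycle :: "'a ugraph \<Rightarrow> 'a list \<Rightarrow> bool" where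
  "graph_cycle G vs \<longleftrightarrow> 3 \<le> length vs \<and> distinct vs \<and>
     (\<forall>i < length vs. {vs ! i, vs ! ((i + 1) mod length vs)} \<in> edges G)"

definition tree_graph :: "'a ugraph \<Rightarrow> bool" where
  "tree_graph G \<longleftrightarrow> simple_graph G \<and> connected_graph G \<and> (\<nexists>vs. graph_cycle G vs)"

definition vertex_degree :: "'a ugraph \<Rightarrow> 'a \<Rightarrow> nat" where
  "vertex_degree G v = card {e \<in> edges G. v \<in> e}"

definition max_degree :: "'a ugraph \<Rightarrow> nat" where
  "max_degree G = Max (vertex_degree G ` vertices G)"

definition is_subgraph :: "'a ugraph \<Rightarrow> 'a ugraph \<Rightarrow> bool" where
  "is_subgraph H G \<longleftrightarrow> simple_graph H \<and> vertices H \<subseteq> vertices G \<and> edges H \<subseteq> edges G"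

definition graph_isomorphic :: "'a ugraph \<Rightarrow> 'b ugraph \<Rightarrow> bool" where
  "graph_isomorphic G H \<longleftrightarrow> (\<exists>f. bij_betw f (vertices G) (vertices H) \<and>
     (\<forall>u \<in> vertices G. \<forall>v \<in> vertices G. {u, v} \<in> edges G \<longleftrightarrow> {f u, f v} \<in> edges H))"

definition is_copy :: "'a ugraph \<Rightarrow> 'b ugraph \<Rightarrow> 'a ugraph \<Rightarrow> bool" where
  "is_copy H T G \<longleftrightarrow> is_subgraph H G \<and> graph_isomorphic T H"

definition edge_colourings :: "'a ugraph \<Rightarrow> nat \<Rightarrow> ('a set \<Rightarrow> nat) set" where
  "edge_colourings G r = edges G \<rightarrow> {1..r}"

end

theory Submission
  imports Defs "HOL-Combinatorics.Permutations"
begin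

text \<open>
  Embed the tree by a uniformly random bijection. The expected number of edges of colour \<open>i\<close> is
  \<open>n - 1\<close> times the density of that colour, which is at least \<open>1/r\<close> for the densest one.
  Swapping the images of two tree vertices \<open>u, v\<close> changes the count by some \<open>G\<close> that changes sign
  under the swap, so choosing the better of the two embeddings gains \<open>E|G|/2\<close> on average; if several
  disjoint pairs together form an independent set of the tree, these gains add up. Swapping in addition
  the images of two vertices \<open>a, b\<close> shows that \<open>2 E|G|\<close> is at least the mean of
  \<open>|w(xa) - w(ya) - w(xb) + w(yb)|\<close>, where \<open>w\<close> is the indicator of colour \<open>i\<close>, as soon as the same
  alternating sum of the tree itself is nonzero at \<open>u, v, a, b\<close>. For nonadjacent \<open>u, v\<close> this just
  requires different neighbourhoods, and a tree has at least \<open>(n - 1 - \<Delta>)/16\<close> such pairs, found among the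
  leaves or among an independent half of the inner vertices. Finally the mean of the alternating sum is of
  order \<open>1/r\<^sup>2\<close> when \<open>n \<ge> 100 r\<close>, since every edge of colour \<open>i\<close> lies in many 4-sets with a nonzero
  alternating sum. For \<open>n < 100 r\<close> a gain of \<open>1/r\<close> suffices, and by integrality this only requires
  excluding that all embeddings are perfectly balanced: then all alternating sums vanish, which forces
  each colour to be empty, complete, a star or the complement of a star, against divisibility by \<open>n\<close>.
\<close>

section \<open>Neighbourhoods, weights of embeddings and alternating sums\<close>

definition neighbours :: "'a set set \<Rightarrow> 'a \<Rightarrow> 'a set" where
  "neighbours E v = {u. {v, u} \<in> E}"

text \<open>The coloured complete graph is transported to the vertex set of the tree, so an
  embedding is a permutation \<open>p\<close>. With \<open>w\<close> the indicator of a colour, this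
  is the number of tree edges that \<open>p\<close> sends to that colour.\<close>

definition weight :: "('a set \<Rightarrow> real) \<Rightarrow> 'a set set \<Rightarrow> ('a \<Rightarrow> 'a) \<Rightarrow> real" where
  "weight w E p = (\<Sum>e\<in>E. w (p ` e))"

text \<open>The sum with alternating signs around the 4-cycle \<open>x, a, y, b\<close>. It is
  applied both to a colour and to the edge indicator of the tree.\<close>

definition alt :: "('a set \<Rightarrow> real) \<Rightarrow> 'a \<Rightarrow> 'a \<Rightarrow> 'a \<Rightarrow> 'a \<Rightarrow> real" where
  "alt w x y a b = w {x, a} - w {y, a} - w {x, b} + w {y, b}"

text \<open>Pairs and quadruples are ordered, so that they form a single orbit under the
  permutations of \<open>V\<close>. Every edge is thus counted twice.\<close>

definition pairs :: "'a set \<Rightarrow> ('a \<times> 'a) set" where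
  "pairs V = {(x, y). x \<in> V \<and> y \<in> V \<and> x \<noteq> y}"

definition quads :: "'a set \<Rightarrow> ('a \<times> 'a \<times> 'a \<times> 'a) set" where
  "quads V = {(x, y, a, b). set [x, y, a, b] \<subseteq> V \<and> distinct [x, y, a, b]}"

lemma pairs_eq: "pairs V = V \<times> V - Id_on V"
  by (auto simp: pairs_def)

lemma finite_pairs: "finite V \<Longrightarrow> finite (pairs V)"
  by (simp add: pairs_eq)

lemma card_pairs:
  assumes "finite V"
  shows "card (pairs V) = card V * (card V - 1)"
proof -
  have "card (pairs V) = card (V \<times> V) - card (Id_on V)"
    unfolding pairs_eq using assms
    by (intro card_Diff_subset) (auto intro: finite_subset[of _ "V \<times> V"])
  also have "Id_on V = (\<lambda>x. (x, x)) ` V"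
    by auto
  then have "card (Id_on V) = card V"
    by (simp add: card_image inj_on_def)
  finally show ?thesis
    by (simp add: card_cartesian_product diff_mult_distrib2)
qed

lemma quads_subset: "quads V \<subseteq> V \<times> V \<times> V \<times> V"
  by (auto simp: quads_def)

lemma finite_quads: "finite V \<Longrightarrow> finite (quads V)"
  by (rule finite_subset[OF quads_subset]) simp

lemma card_quads_le: "finite V \<Longrightarrow> card (quads V) \<le> card V ^ 4"
  using card_mono[OF _ quads_subset, of V]
  by (simp add: card_cartesian_product power4_eq_xxxx mult.assoc)

section \<open>Double counting: a random permutation sends a fixed tuple to a uniform one\<close>

subsection \<open>Averages over permutations\<close>

text \<open>Once \<open>p\<close> matches the tails, composing with the transposition of
  \<open>p x\<close> and \<open>y\<close> also matches the heads. It leaves the tails alone, since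
  neither \<open>p x\<close> nor \<open>y\<close> occurs in \<open>ys\<close>.\<close>

lemma permutes_map_lists:
  assumes "length xs = length ys" "distinct xs" "distinct ys" "set xs \<subseteq> V" "set ys \<subseteq> V"
  shows "\<exists>p. p permutes V \<and> map p xs = ys"
  using assms
proof (induction xs ys rule: list_induct2)
  case Nil
  have "map id [] = ([] :: 'a list)"
    by simp
  with permutes_id[of V] show ?case
    by blast
next
  case (Cons x xs y ys)
  have "\<exists>p. p permutes V \<and> map p xs = ys"
    using Cons.prems by (intro Cons.IH) simp_all
  then obtain p where p: "p permutes V" "map p xs = ys"
    by blast
  let ?q = "Transposition.transpose (p x) y \<circ> p"
  have "?q permutes V"
    using Cons.prems permutes_in_image[OF p(1)]
    by (intro permutes_compose[OF p(1)] permutes_swap_id) simp_all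
  moreover have "?q z = p z" if z: "z \<in> set xs" for z
  proof -
    have "p z \<noteq> p x"
      using z Cons.prems(1) inj_eq[OF permutes_inj[OF p(1)]] by auto
    moreover have "p z \<in> set ys"
      using z p(2) by (metis imageI set_map)
    then have "p z \<noteq> y"
      using Cons.prems(2) by auto
    ultimately show ?thesis
      by simp
  qed
  then have "map ?q xs = ys"
    using p(2) by (metis map_cong)
  then have "map ?q (x # xs) = y # ys"
    by (simp only: list.map comp_apply transpose_apply_first)
  ultimately show ?case
    by (intro exI[of _ ?q] conjI)
qed

text \<open>Changing the base point from \<open>t\<close> to \<open>s\<close> only reindexes the sum
  by a right multiplication, so all base points give the same sum. Adding over all \<open>s\<close>
  and exchanging the sums, each \<open>act p\<close> merely rearranges
  \<open>\<Gamma>\<close>.\<close>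

lemma sum_over_permutations_transitive:
  fixes h :: "'b \<Rightarrow> real" and act :: "('a \<Rightarrow> 'a) \<Rightarrow> 'b \<Rightarrow> 'b"
  assumes "finite V"
    and trans: "\<And>s. s \<in> \<Gamma> \<Longrightarrow> \<exists>q. q permutes V \<and> act q t = s"
    and comp: "\<And>p q s. act (p \<circ> q) s = act p (act q s)"
    and bij: "\<And>p. p permutes V \<Longrightarrow> bij_betw (act p) \<Gamma> \<Gamma>"
  shows "real (card \<Gamma>) * (\<Sum>p | p permutes V. h (act p t)) = fact (card V) * (\<Sum>s\<in>\<Gamma>. h s)"
proof -
  have "(\<Sum>p | p permutes V. h (act p s)) = (\<Sum>p | p permutes V. h (act p t))" if "s \<in> \<Gamma>" for s
  proof -
    obtain q where "q permutes V" "act q t = s"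
      using trans[OF \<open>s \<in> \<Gamma>\<close>] by blast
    then show ?thesis
      using sum_permutations_compose_right[of q V "\<lambda>p. h (act p t)"] comp by simp
  qed
  then have "real (card \<Gamma>) * (\<Sum>p | p permutes V. h (act p t))
      = (\<Sum>s\<in>\<Gamma>. \<Sum>p | p permutes V. h (act p s))"
    by simp
  also have "\<dots> = (\<Sum>p | p permutes V. \<Sum>s\<in>\<Gamma>. h (act p s))"
    by (rule sum.swap)
  also have "\<dots> = (\<Sum>p | p permutes V. \<Sum>s\<in>\<Gamma>. h s)"
    using bij by (intro sum.cong refl sum.reindex_bij_betw) simp
  finally show ?thesis
    using card_permutations[OF refl \<open>finite V\<close>] by simp
qed

lemma bij_betw_invariant:
  assumes "finite \<Gamma>" "inj f" "f ` \<Gamma> \<subseteq> \<Gamma>"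
  shows "bij_betw f \<Gamma> \<Gamma>"
  unfolding bij_betw_def
  using endo_inj_surj[OF assms(1,3)] inj_on_subset[OF assms(2) subset_UNIV] by simp

text \<open>Here and for quadruples, denominators are cleared: the mean of \<open>h\<close> at the
  random image of a fixed tuple is its mean over all tuples.\<close>

lemma sum_permutations_pair:
  fixes h :: "'a \<Rightarrow> 'a \<Rightarrow> real"
  assumes V: "finite V" and st: "(s, t) \<in> pairs V"
  shows "real (card (pairs V)) * (\<Sum>p | p permutes V. h (p s) (p t))
    = fact (card V) * (\<Sum>(x, y)\<in>pairs V. h x y)"
proof -
  let ?act = "\<lambda>p. map_prod p p"
  have "real (card (pairs V)) * (\<Sum>p | p permutes V. (\<lambda>(x, y). h x y) (?act p (s, t)))
    = fact (card V) * (\<Sum>u\<in>pairs V. (\<lambda>(x, y). h x y) u)"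
  proof (rule sum_over_permutations_transitive[OF V])
    fix u assume u: "u \<in> pairs V"
    obtain x y where "u = (x, y)"
      by (cases u)
    with u st have "\<exists>q. q permutes V \<and> map q [s, t] = [x, y]"
      by (intro permutes_map_lists) (simp_all add: pairs_def)
    then obtain q where "q permutes V" "map q [s, t] = [x, y]"
      by (elim exE conjE)
    with \<open>u = (x, y)\<close> show "\<exists>q. q permutes V \<and> ?act q (s, t) = u"
      by (intro exI[of _ q]) simp
  next
    fix p :: "'a \<Rightarrow> 'a" assume p: "p permutes V"
    have inj: "inj p"
      by (rule permutes_inj[OF p])
    show "bij_betw (?act p) (pairs V) (pairs V)"
    proof (rule bij_betw_invariant)
      show "inj (?act p)"
        by (intro prod.inj_map inj)
      show "?act p ` pairs V \<subseteq> pairs V"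
        unfolding pairs_def using permutes_in_image[OF p] inj_eq[OF inj] by auto
    qed (rule finite_pairs[OF V])
  qed (simp add: map_prod_def split_beta)
  then show ?thesis
    unfolding map_prod_simp prod.case .
qed

lemma sum_permutations_quad:
  fixes h :: "'a \<Rightarrow> 'a \<Rightarrow> 'a \<Rightarrow> 'a \<Rightarrow> real"
  assumes V: "finite V" and st: "(s1, s2, s3, s4) \<in> quads V"
  shows "real (card (quads V)) * (\<Sum>p | p permutes V. h (p s1) (p s2) (p s3) (p s4))
    = fact (card V) * (\<Sum>(x, y, a, b)\<in>quads V. h x y a b)"
proof -
  let ?act = "\<lambda>p. map_prod p (map_prod p (map_prod p p))"
  let ?h = "\<lambda>(x, y, a, b). h x y a b"
  have "real (card (quads V)) * (\<Sum>p | p permutes V. ?h (?act p (s1, s2, s3, s4)))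
    = fact (card V) * (\<Sum>u\<in>quads V. ?h u)"
  proof (rule sum_over_permutations_transitive[OF V])
    fix u assume u: "u \<in> quads V"
    obtain x y a b where "u = (x, y, a, b)"
      using prod_cases4 by blast
    with u st have "\<exists>q. q permutes V \<and> map q [s1, s2, s3, s4] = [x, y, a, b]"
      by (intro permutes_map_lists) (simp_all add: quads_def)
    then obtain q where "q permutes V" "map q [s1, s2, s3, s4] = [x, y, a, b]"
      by (elim exE conjE)
    with \<open>u = (x, y, a, b)\<close> show "\<exists>q. q permutes V \<and> ?act q (s1, s2, s3, s4) = u"
      by (intro exI[of _ q]) simp
  next
    fix p :: "'a \<Rightarrow> 'a" assume p: "p permutes V"
    have inj: "inj p"
      by (rule permutes_inj[OF p])
    show "bij_betw (?act p) (quads V) (quads V)"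
    proof (rule bij_betw_invariant)
      show "inj (?act p)"
        by (intro prod.inj_map inj)
      show "?act p ` quads V \<subseteq> quads V"
        unfolding quads_def by (clarsimp simp: permutes_in_image[OF p] inj_eq[OF inj])
    qed (rule finite_quads[OF V])
  qed (simp add: map_prod_def split_beta)
  then show ?thesis
    unfolding map_prod_simp prod.case .
qed

text \<open>Linearity of expectation: every tree edge contributes the mean of \<open>w\<close> over
  ordered pairs.\<close>

lemma sum_weight:
  assumes V: "finite V" and E: "E \<subseteq> [V]\<^bsup>2\<^esup>"
  shows "real (card (pairs V)) * (\<Sum>p | p permutes V. weight w E p)
    = fact (card V) * real (card E) * (\<Sum>(x, y)\<in>pairs V. w {x, y})"
proof -
  have *: "real (card (pairs V)) * (\<Sum>p | p permutes V. w (p ` e))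
      = fact (card V) * (\<Sum>(x, y)\<in>pairs V. w {x, y})" if e: "e \<in> E" for e
  proof -
    obtain s t where st: "e = {s, t}" "(s, t) \<in> pairs V"
    proof (rule nsets2_E)
      show "e \<in> [V]\<^bsup>2\<^esup>"
        using E e by blast
    qed (auto simp: pairs_def)
    show ?thesis
      using sum_permutations_pair[OF V st(2), of "\<lambda>x y. w {x, y}"]
      unfolding st(1) image_insert image_empty .
  qed
  have "real (card (pairs V)) * (\<Sum>p | p permutes V. weight w E p)
      = (\<Sum>e\<in>E. real (card (pairs V)) * (\<Sum>p | p permutes V. w (p ` e)))"
    unfolding weight_def sum_distrib_left by (rule sum.swap)
  also have "\<dots> = (\<Sum>e\<in>E. fact (card V) * (\<Sum>(x, y)\<in>pairs V. w {x, y}))"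
    by (intro sum.cong refl *)
  also have "\<dots> = real (card E) * (fact (card V) * (\<Sum>(x, y)\<in>pairs V. w {x, y}))"
    by (rule sum_constant)
  finally show ?thesis
    by (simp only: mult_ac)
qed

section \<open>Gains from transposing two tree vertices, and their second differences\<close>

subsection \<open>Switches\<close>

text \<open>Since \<open>\<tau>\<close> and \<open>\<theta>\<close> commute, an edge fixed as a set
  by one of them cancels out. Only the four possible edges between \<open>{u, v}\<close> and
  \<open>{a, b}\<close> remain, and each contributes the same alternating sum of \<open>w\<close> up
  to sign.\<close>

lemma weight_second_difference:
  assumes "finite E" and E2: "\<And>e. e \<in> E \<Longrightarrow> card e = 2" and d: "distinct [u, v, a, b]"
  defines "\<tau> \<equiv> Transposition.transpose u v" and "\<theta> \<equiv> Transposition.transpose a b"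
  shows "weight w E (p \<circ> \<tau>) - weight w E p - weight w E (p \<circ> \<theta> \<circ> \<tau>) + weight w E (p \<circ> \<theta>)
    = - (alt (\<lambda>e. of_bool (e \<in> E)) u v a b * alt w (p u) (p v) (p a) (p b))"
proof -
  define \<phi> where "\<phi> e = w (p ` \<tau> ` e) - w (p ` e) - w (p ` \<theta> ` \<tau> ` e) + w (p ` \<theta> ` e)" for e
  define F where "F = {{u, a}, {u, b}, {v, a}, {v, b}}"
  have \<phi>0: "\<phi> e = 0" if e: "e \<in> E" "e \<notin> F" for e
  proof -
    obtain s t where st: "e = {s, t}" "s \<noteq> t"
      using E2[OF e(1)] by (auto simp: card_2_iff)
    \<comment> \<open>An edge moved by a transposition contains exactly one of the two exchanged
      points. Hence an edge moved by both \<open>\<tau>\<close> and \<open>\<theta>\<close> is a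
      cross edge, an element of \<open>F\<close>.\<close>
    have swap: "Transposition.transpose x y ` e = e" if "s \<in> {x, y} \<longleftrightarrow> t \<in> {x, y}" for x y
    proof (cases "s \<in> {x, y}")
      case True
      then have "e = {x, y}"
        using that st by auto
      then show ?thesis
        by auto
    next
      case False
      then show ?thesis
        using that st by simp
    qed
    have "e \<in> F" if st_cross: "(s \<in> {u, v}) \<noteq> (t \<in> {u, v})" "(s \<in> {a, b}) \<noteq> (t \<in> {a, b})"
    proof -
      consider "s \<in> {u, v}" "t \<in> {a, b}" | "t \<in> {u, v}" "s \<in> {a, b}"
        using st_cross d by auto
      then show ?thesis
        unfolding st(1) F_def by cases (auto simp: insert_commute)
    qed
    then consider "\<tau> ` e = e" | "\<theta> ` e = e" | "e \<in> F"
      using swap unfolding \<tau>_def \<theta>_def by blast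
    then show ?thesis
    proof cases
      case 2
      have "\<theta> ` \<tau> ` e = \<tau> ` \<theta> ` e"
        using d unfolding \<tau>_def \<theta>_def image_image Transposition.transpose_def
        by (intro image_cong) auto
      with 2 show ?thesis
        by (simp add: \<phi>_def)
    qed (use e in \<open>simp_all add: \<phi>_def\<close>)
  qed
  have "weight w E (p \<circ> \<tau>) - weight w E p - weight w E (p \<circ> \<theta> \<circ> \<tau>) + weight w E (p \<circ> \<theta>) = sum \<phi> E"
    unfolding weight_def \<phi>_def by (simp add: sum.distrib sum_subtractf image_comp comp_assoc)
  also have "\<dots> = sum \<phi> (E \<inter> F)"
    using \<phi>0 \<open>finite E\<close> by (intro sum.mono_neutral_right) auto
  also have "\<dots> = (\<Sum>e\<in>F. if e \<in> E then \<phi> e else 0)"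
    by (subst Int_commute, rule sum.inter_restrict) (simp add: F_def)
  also have "\<dots> = (\<Sum>e\<leftarrow>[{u, a}, {u, b}, {v, a}, {v, b}]. if e \<in> E then \<phi> e else 0)"
    unfolding F_def using d
    by (subst sum_list_distinct_conv_sum_set) (auto simp: doubleton_eq_iff)
  also have "\<dots> = - (alt (\<lambda>e. of_bool (e \<in> E)) u v a b * alt w (p u) (p v) (p a) (p b))"
  proof -
    have "\<tau> u = v" "\<tau> v = u" "\<tau> a = a" "\<tau> b = b" "\<theta> u = u" "\<theta> v = v" "\<theta> a = b" "\<theta> b = a"
      unfolding \<tau>_def \<theta>_def using d by auto
    then have "\<phi> {u, a} = - alt w (p u) (p v) (p a) (p b)"
      "\<phi> {u, b} = alt w (p u) (p v) (p a) (p b)"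
      "\<phi> {v, a} = alt w (p u) (p v) (p a) (p b)"
      "\<phi> {v, b} = - alt w (p u) (p v) (p a) (p b)"
      unfolding \<phi>_def alt_def by simp_all
    then show ?thesis
      by (simp add: alt_def algebra_simps)
  qed
  finally show ?thesis .
qed

text \<open>The gain of a switch is not affected by the other switches, so each one can be decided separately.\<close>

lemma greedy_switches:
  fixes X :: "'b \<Rightarrow> real" and step :: "'j \<Rightarrow> 'b \<Rightarrow> 'b"
  assumes "finite J"
    and "\<And>j p. j \<in> J \<Longrightarrow> p \<in> \<Omega> \<Longrightarrow> step j p \<in> \<Omega>"
    and "\<And>j k p. j \<in> J \<Longrightarrow> k \<in> J \<Longrightarrow> j \<noteq> k \<Longrightarrow> p \<in> \<Omega> \<Longrightarrow>
      X (step j (step k p)) - X (step k p) = X (step j p) - X p"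
    and "p \<in> \<Omega>"
  shows "\<exists>q\<in>\<Omega>. X p + (\<Sum>j\<in>J. max 0 (X (step j p) - X p)) \<le> X q"
  using assms
proof (induction J arbitrary: p rule: finite_induct)
  case empty
  then show ?case
    by auto
next
  case (insert k J)
  have IH: "\<exists>q\<in>\<Omega>. X p' + (\<Sum>j\<in>J. max 0 (X (step j p') - X p')) \<le> X q" if p': "p' \<in> \<Omega>" for p'
    using insert.prems(1,2) p' by (intro insert.IH) simp_all
  show ?case
  proof (cases "X (step k p) \<le> X p")
    case True
    then show ?thesis
      using IH[OF insert.prems(3)] insert.hyps by simp
  next
    case False
    have "(\<Sum>j\<in>J. max 0 (X (step j (step k p)) - X (step k p))) = (\<Sum>j\<in>J. max 0 (X (step j p) - X p))"
    proof (intro sum.cong refl)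
      fix j assume j: "j \<in> J"
      then have "j \<noteq> k"
        using insert.hyps by auto
      then show "max 0 (X (step j (step k p)) - X (step k p)) = max 0 (X (step j p) - X p)"
        using insert.prems(2)[of j k p] insert.prems(3) j by simp
    qed
    moreover obtain q where "q \<in> \<Omega>"
      "X (step k p) + (\<Sum>j\<in>J. max 0 (X (step j (step k p)) - X (step k p))) \<le> X q"
      using IH[of "step k p"] insert.prems by auto
    ultimately show ?thesis
      using False insert.hyps by (intro bexI[of _ q]) simp_all
  qed
qed

lemma transpose_image_disjoint: "e \<inter> {u, v} = {} \<Longrightarrow> Transposition.transpose u v ` e = e"
  by (simp add: Transposition.transpose_def image_def) auto

text \<open>An edge meeting both pairs would lie inside \<open>{u, v, x, y}\<close>, so every edge
  is fixed by one of the two commuting transpositions. No edge then feels both switches.\<close>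

lemma weight_switch_additive:
  assumes E2: "\<And>e. e \<in> E \<Longrightarrow> card e = 2" and disj: "{u, v} \<inter> {x, y} = {}"
    and indep: "\<And>e. e \<in> E \<Longrightarrow> \<not> e \<subseteq> {u, v, x, y}"
  defines "\<tau> \<equiv> Transposition.transpose u v" and "\<sigma> \<equiv> Transposition.transpose x y"
  shows "weight w E (p \<circ> \<sigma> \<circ> \<tau>) - weight w E (p \<circ> \<sigma>) = weight w E (p \<circ> \<tau>) - weight w E p"
proof -
  have "w ((p \<circ> \<sigma> \<circ> \<tau>) ` e) - w ((p \<circ> \<sigma>) ` e) = w ((p \<circ> \<tau>) ` e) - w (p ` e)" if e: "e \<in> E" for e
  proof -
    obtain s t where st: "e = {s, t}"
      using E2[OF e] by (auto simp: card_2_iff)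
    have "e \<inter> {u, v} = {} \<or> e \<inter> {x, y} = {}"
      using indep[OF e] disj unfolding st by auto
    then consider "\<tau> ` e = e" | "\<sigma> ` e = e"
      unfolding \<tau>_def \<sigma>_def using transpose_image_disjoint by metis
    then show ?thesis
    proof cases
      case 1
      then have "(p \<circ> \<sigma> \<circ> \<tau>) ` e = (p \<circ> \<sigma>) ` e" "(p \<circ> \<tau>) ` e = p ` e"
        by (simp_all only: image_comp[symmetric])
      then show ?thesis
        by simp
    next
      case 2
      have "\<sigma> \<circ> \<tau> = \<tau> \<circ> \<sigma>"
      proof
        fix z
        show "(\<sigma> \<circ> \<tau>) z = (\<tau> \<circ> \<sigma>) z"
          unfolding \<tau>_def \<sigma>_def using disj by (cases "z \<in> {u, v}"; cases "z \<in> {x, y}") auto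
      qed
      then have "(p \<circ> \<sigma> \<circ> \<tau>) ` e = (p \<circ> \<tau>) ` \<sigma> ` e"
        by (simp only: image_comp comp_assoc)
      moreover have "(p \<circ> \<sigma>) ` e = p ` \<sigma> ` e"
        by (simp only: image_comp)
      ultimately show ?thesis
        using 2 by simp
    qed
  qed
  then show ?thesis
    unfolding weight_def sum_subtractf[symmetric] by (intro sum.cong refl)
qed

text \<open>The factor 4 arises from two doublings: the alternating sum is bounded by the gains
  \<open>G\<close> at two embeddings, and \<open>\<bar>G\<bar>\<close> has twice the mean of the
  positive part of \<open>G\<close>.\<close>

lemma sum_abs_switch_ge:
  assumes V: "finite V" and E: "E \<subseteq> [V]\<^bsup>2\<^esup>"
    and uv: "(u, v, a, b) \<in> quads V" "alt (\<lambda>e. of_bool (e \<in> E)) u v a b \<noteq> 0"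
  shows "(\<Sum>p | p permutes V. \<bar>alt w (p u) (p v) (p a) (p b)\<bar>)
    \<le> 4 * (\<Sum>p | p permutes V. max 0 (weight w E (p \<circ> Transposition.transpose u v) - weight w E p))"
proof -
  let ?\<tau> = "Transposition.transpose u v" and ?\<theta> = "Transposition.transpose a b"
  let ?S = "\<lambda>f. \<Sum>p | p permutes V. f p"
  define G where "G p = weight w E (p \<circ> ?\<tau>) - weight w E p" for p
  have perm: "?\<tau> permutes V" "?\<theta> permutes V" and d: "distinct [u, v, a, b]"
    using uv(1) by (auto simp: quads_def intro: permutes_swap_id)
  have finE: "finite E"
    by (rule finite_subset[OF E finite_imp_finite_nsets[OF V]])
  have E2: "card e = 2" if "e \<in> E" for e
    using that E by (auto simp: nsets_def)
  \<comment> \<open>The alternating sum of the tree is a nonzero integer.\<close>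
  have \<kappa>: "1 \<le> \<bar>alt (\<lambda>e. of_bool (e \<in> E) :: real) u v a b\<bar>"
    using uv(2) by (auto simp: alt_def of_bool_def split: if_splits)
  have "\<bar>alt w (p u) (p v) (p a) (p b)\<bar> \<le> \<bar>G p\<bar> + \<bar>G (p \<circ> ?\<theta>)\<bar>" for p
  proof -
    have "\<bar>alt w (p u) (p v) (p a) (p b)\<bar>
        \<le> \<bar>alt (\<lambda>e. of_bool (e \<in> E)) u v a b\<bar> * \<bar>alt w (p u) (p v) (p a) (p b)\<bar>"
      using mult_right_mono[OF \<kappa>, of "\<bar>alt w (p u) (p v) (p a) (p b)\<bar>"] by simp
    also have "\<dots> = \<bar>G p - G (p \<circ> ?\<theta>)\<bar>"
      using weight_second_difference[OF finE E2 d, of w p] unfolding G_def abs_mult[symmetric]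
      by linarith
    finally show ?thesis
      by linarith
  qed
  then have "?S (\<lambda>p. \<bar>alt w (p u) (p v) (p a) (p b)\<bar>) \<le> ?S (\<lambda>p. \<bar>G p\<bar> + \<bar>G (p \<circ> ?\<theta>)\<bar>)"
    by (intro sum_mono)
  also have "\<dots> = 2 * ?S (\<lambda>p. \<bar>G p\<bar>)"
    using sum_permutations_compose_right[OF perm(2), of "\<lambda>p. \<bar>G p\<bar>"] by (simp add: sum.distrib)
  \<comment> \<open>Undoing the switch reverses the sign of \<open>G\<close>, so the negative part
    of \<open>G\<close> at \<open>p\<close> is its positive part at the switched embedding.\<close>
  also have "?S (\<lambda>p. \<bar>G p\<bar>) = ?S (\<lambda>p. max 0 (G p)) + ?S (\<lambda>p. max 0 (G (p \<circ> ?\<tau>)))"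
  proof -
    have "G (p \<circ> ?\<tau>) = - G p" for p
      unfolding G_def comp_assoc transpose_comp_involutory by simp
    then have "\<bar>G p\<bar> = max 0 (G p) + max 0 (G (p \<circ> ?\<tau>))" for p
      by simp
    then show ?thesis
      by (simp add: sum.distrib)
  qed
  also have "?S (\<lambda>p. max 0 (G (p \<circ> ?\<tau>))) = ?S (\<lambda>p. max 0 (G p))"
    by (rule sum_permutations_compose_right[OF perm(1), symmetric])
  finally show ?thesis
    by (simp add: G_def)
qed

text \<open>From each \<open>p\<close>, greedy switching reaches an embedding whose weight exceeds
  that of \<open>p\<close> by all positive gains together, and \<open>M\<close> bounds this weight
  as well. Averaging over \<open>p\<close> gives the mean weight plus, for each pair in
  \<open>J\<close>, at least a quarter of the mean absolute alternating sum.\<close>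

lemma switching_bound:
  assumes V: "finite V" "2 \<le> card V" and E: "E \<subseteq> [V]\<^bsup>2\<^esup>" and J: "finite J"
    and disj: "\<And>u v x y. (u, v) \<in> J \<Longrightarrow> (x, y) \<in> J \<Longrightarrow> (u, v) \<noteq> (x, y) \<Longrightarrow> {u, v} \<inter> {x, y} = {}"
    and indep: "\<And>u v x y e. (u, v) \<in> J \<Longrightarrow> (x, y) \<in> J \<Longrightarrow> e \<in> E \<Longrightarrow> \<not> e \<subseteq> {u, v, x, y}"
    and nontrivial: "\<And>u v. (u, v) \<in> J \<Longrightarrow>
      \<exists>a b. (u, v, a, b) \<in> quads V \<and> alt (\<lambda>e. of_bool (e \<in> E) :: real) u v a b \<noteq> 0"
    and M: "\<And>p. p permutes V \<Longrightarrow> weight w E p \<le> M"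
  shows "real (card E) * (\<Sum>(x, y)\<in>pairs V. w {x, y}) / real (card (pairs V))
    + real (card J) / 4 * ((\<Sum>(x, y, a, b)\<in>quads V. \<bar>alt w x y a b\<bar>) / real (card (quads V))) \<le> M"
proof -
  let ?S = "\<lambda>f :: ('a \<Rightarrow> 'a) \<Rightarrow> real. \<Sum>p | p permutes V. f p"
  let ?A = "\<Sum>(x, y, a, b)\<in>quads V. \<bar>alt w x y a b\<bar>"
  let ?W = "\<Sum>(x, y)\<in>pairs V. w {x, y}"
  let ?n = "fact (card V) :: real"
  define step where "step = (\<lambda>(u, v) (p :: 'a \<Rightarrow> 'a). p \<circ> Transposition.transpose u v)"
  define G where "G j p = max 0 (weight w E (step j p) - weight w E p)" for j p
  have E2: "card e = 2" if "e \<in> E" for e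
    using that E by (auto simp: nsets_def)
  have JV: "u \<in> V" "v \<in> V" if "(u, v) \<in> J" for u v
    using nontrivial[OF that] by (auto simp: quads_def)
  have "weight w E p + (\<Sum>j\<in>J. G j p) \<le> M" if p: "p permutes V" for p
  proof -
    have "\<exists>q\<in>{p. p permutes V}.
        weight w E p + (\<Sum>j\<in>J. max 0 (weight w E (step j p) - weight w E p)) \<le> weight w E q"
    proof (rule greedy_switches[OF J])
      fix j p assume "j \<in> J" "p \<in> {p. p permutes V}"
      then show "step j p \<in> {p. p permutes V}"
        using JV by (cases j) (simp add: step_def permutes_compose permutes_swap_id)
    next
      fix j k p assume jk: "j \<in> J" "k \<in> J" "j \<noteq> k"
      obtain u v x y where "j = (u, v)" "k = (x, y)"
        by (cases j, cases k)
      then show "weight w E (step j (step k p)) - weight w E (step k p)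
          = weight w E (step j p) - weight w E p"
        using weight_switch_additive[OF E2 disj indep, of E u v x y] jk by (simp add: step_def)
    qed (use p in simp)
    then show ?thesis
      using M unfolding G_def by force
  qed
  then have "?S (\<lambda>p. weight w E p + (\<Sum>j\<in>J. G j p)) \<le> ?S (\<lambda>p. M)"
    by (intro sum_mono) simp
  also have "?S (\<lambda>p. M) = ?n * M"
    using card_permutations[OF refl V(1)] by simp
  also have "?S (\<lambda>p. weight w E p + (\<Sum>j\<in>J. G j p))
      = ?S (weight w E) + (\<Sum>j\<in>J. ?S (G j))"
    unfolding sum.distrib by (subst sum.swap) simp
  finally have "?S (weight w E) + (\<Sum>j\<in>J. ?S (G j)) \<le> ?n * M" .
  moreover have "?S (weight w E) = ?n * (real (card E) * ?W / real (card (pairs V)))"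
  proof -
    have "real (card (pairs V)) \<noteq> 0"
      using V by (auto simp: card_pairs)
    then show ?thesis
      using sum_weight[OF V(1) E, of w] by (simp add: field_simps)
  qed
  moreover have "?n * (?A / real (card (quads V)) / 4) \<le> ?S (G j)" if j: "j \<in> J" for j
  proof -
    obtain u v where uv: "j = (u, v)"
      by (cases j)
    then obtain a b where ab: "(u, v, a, b) \<in> quads V"
      "alt (\<lambda>e. of_bool (e \<in> E) :: real) u v a b \<noteq> 0"
      using nontrivial j by blast
    then have "real (card (quads V)) \<noteq> 0"
      using finite_quads[OF V(1)] by auto
    then have "?n * (?A / real (card (quads V))) = ?S (\<lambda>p. \<bar>alt w (p u) (p v) (p a) (p b)\<bar>)"
      using sum_permutations_quad[OF V(1) ab(1), of "\<lambda>x y a b. \<bar>alt w x y a b\<bar>"]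
      by (simp add: field_simps)
    also have "\<dots> \<le> 4 * ?S (G j)"
      using sum_abs_switch_ge[OF V(1) E ab] by (simp add: G_def step_def uv)
    finally show ?thesis
      by simp
  qed
  then have "real (card J) * (?n * (?A / real (card (quads V)) / 4)) \<le> (\<Sum>j\<in>J. ?S (G j))"
    by (rule sum_bounded_below)
  moreover have "?n * (real (card E) * ?W / real (card (pairs V))
      + real (card J) / 4 * (?A / real (card (quads V))))
    = ?n * (real (card E) * ?W / real (card (pairs V)))
      + real (card J) * (?n * (?A / real (card (quads V)) / 4))"
    by (simp add: distrib_left mult_ac)
  ultimately have "?n * (real (card E) * ?W / real (card (pairs V))
      + real (card J) / 4 * (?A / real (card (quads V)))) \<le> ?n * M"
    by linarith
  then show ?thesis
    by (simp add: mult_le_cancel_left_pos)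
qed

section \<open>Graphs with few, or no, nonzero alternating sums on four vertices\<close>

subsection \<open>Alternating sums of a colour class\<close>

text \<open>
  Fix an edge \<open>ab\<close> and split the other vertices into common neighbours \<open>A\<close>, common non-neighbours \<open>B\<close>
  and the rest \<open>M\<close>. If few pairs are bad, then \<open>A\<close> spans most edges, so \<open>M\<close> and \<open>B\<close> are small and
  there are too few non-edges.
\<close>

lemma unbalanced_edge_pairs:
  fixes V :: "'a set" and K :: "'a set set"
  defines "w \<equiv> (\<lambda>e. of_bool (e \<in> K)) :: 'a set \<Rightarrow> real"
    and "P \<equiv> {(x, y) \<in> pairs V. {x, y} \<in> K}"
  assumes V: "finite V" "200 \<le> card V"
    and d: "8 * card V \<le> card P" "16 * card P \<le> 11 * (card V * (card V - 1))"
    and ab: "(a, b) \<in> P"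
  shows "card P \<le> 800 * card {(x, y) \<in> pairs (V - {a, b}). alt w a y b x \<noteq> 0 \<or> alt w a x b y \<noteq> 0}"
proof (rule ccontr)
  define V' where "V' = V - {a, b}"
  define Bad where "Bad = {(x, y) \<in> pairs V'. alt w a y b x \<noteq> 0 \<or> alt w a x b y \<noteq> 0}"
  define A where "A = {x \<in> V'. {a, x} \<in> K \<and> {b, x} \<in> K}"
  define B where "B = {x \<in> V'. {a, x} \<notin> K \<and> {b, x} \<notin> K}"
  define M where "M = {x \<in> V'. ({a, x} \<in> K) \<noteq> ({b, x} \<in> K)}"
  define P' where "P' = {(x, y) \<in> pairs V'. {x, y} \<in> K}"
  define N' where "N' = {(x, y) \<in> pairs V'. {x, y} \<notin> K}"
  define n d \<alpha> \<beta> \<mu> \<epsilon> \<nu> where defs: "n = real (card V)" "d = real (card P)" "\<alpha> = real (card A)"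
    "\<beta> = real (card B)" "\<mu> = real (card M)" "\<epsilon> = real (card Bad)" "\<nu> = real (card N')"
  assume "\<not> ?thesis"
  then have eps: "800 * \<epsilon> < d"
    unfolding defs Bad_def V'_def by linarith
  have abK: "{a, b} \<in> K" "a \<in> V" "b \<in> V" "a \<noteq> b"
    using ab by (auto simp: P_def pairs_def)
  have fin: "finite V'" "finite A" "finite B" "finite M" "finite Bad" "finite P'" "finite N'"
    using V(1) finite_pairs[of V']
    by (auto simp: V'_def A_def B_def M_def Bad_def P'_def N'_def intro: rev_finite_subset)
  \<comment> \<open>As \<open>ab\<close> is an edge, it contributes 1 to both alternating sums; a
    pair is good when both of these equations hold.\<close>
  have bad: "alt w a y b x \<noteq> 0 \<or> alt w a x b y \<noteq> 0 \<longleftrightarrow>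
      \<not> (1 + w {x, y} = w {a, x} + w {b, y} \<and> 1 + w {x, y} = w {a, y} + w {b, x})" for x y
    using abK unfolding alt_def by (auto simp: w_def insert_commute)
  \<comment> \<open>For an edge \<open>xy\<close> the left sides are 2, so a good pair is joined
    completely to \<open>a\<close> and \<open>b\<close>.\<close>
  have P'_sub: "P' \<subseteq> Bad \<union> A \<times> A"
    unfolding P'_def Bad_def A_def bad by (auto simp: pairs_def w_def of_bool_def split: if_splits)
  \<comment> \<open>For \<open>x\<close> in \<open>A\<close> the two equations would give
    \<open>y\<close> the same adjacency to \<open>a\<close> and \<open>b\<close>. Within
    \<open>B\<close> the right sides are 0, which is impossible.\<close>
  have AM: "A \<times> M \<subseteq> Bad"
    unfolding Bad_def A_def M_def bad by (auto simp: pairs_def w_def of_bool_def split: if_splits)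
  have BB: "pairs B \<subseteq> Bad"
    unfolding Bad_def B_def bad by (auto simp: pairs_def w_def of_bool_def split: if_splits)
  \<comment> \<open>For a good non-edge \<open>xy\<close> both sums equal 1, so \<open>y\<close> is
    adjacent to \<open>a\<close> exactly if \<open>x\<close> is not adjacent to \<open>b\<close>,
    and likewise with \<open>a\<close> and \<open>b\<close> exchanged. This pairs \<open>A\<close>
    with \<open>B\<close> and \<open>M\<close> with \<open>M\<close>.\<close>
  have N'_sub: "N' \<subseteq> Bad \<union> A \<times> B \<union> B \<times> A \<union> M \<times> M"
    unfolding N'_def Bad_def A_def B_def M_def bad
    by (auto simp: pairs_def w_def of_bool_def split: if_splits)
  have "card P' \<le> card (Bad \<union> A \<times> A)"
    using fin P'_sub by (intro card_mono) auto
  also have "\<dots> \<le> card Bad + card A * card A"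
    using card_Un_le[of Bad "A \<times> A"] by (simp add: card_cartesian_product)
  finally have 1: "real (card P') \<le> \<epsilon> + \<alpha> * \<alpha>"
    unfolding defs by (simp flip: of_nat_mult of_nat_add)
  have "card A * card M \<le> card Bad"
    using card_mono[OF fin(5) AM] by (simp add: card_cartesian_product)
  then have 2: "\<alpha> * \<mu> \<le> \<epsilon>"
    unfolding defs by (simp flip: of_nat_mult)
  have "card B * (card B - 1) \<le> card Bad"
    using card_mono[OF fin(5) BB] fin(3) by (simp add: card_pairs)
  then have "real (card B * (card B - 1)) \<le> \<epsilon>"
    unfolding defs by (rule of_nat_mono)
  then have 3: "\<beta> * (\<beta> - 1) \<le> \<epsilon>"
    unfolding defs by (cases "card B") (simp_all add: algebra_simps)
  have "card N' \<le> card (Bad \<union> A \<times> B \<union> B \<times> A \<union> M \<times> M)"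
    using fin N'_sub by (intro card_mono) auto
  also have "\<dots> \<le> card Bad + card A * card B + card B * card A + card M * card M"
    using card_Un_le[of "Bad \<union> A \<times> B \<union> B \<times> A" "M \<times> M"] card_Un_le[of "Bad \<union> A \<times> B" "B \<times> A"]
      card_Un_le[of Bad "A \<times> B"] by (simp add: card_cartesian_product)
  finally have "real (card N') \<le> real (card Bad + card A * card B + card B * card A + card M * card M)"
    by (rule of_nat_mono)
  then have 4: "\<nu> \<le> \<epsilon> + 2 * (\<alpha> * \<beta>) + \<mu> * \<mu>"
    unfolding defs by simp
  have "P \<subseteq> P' \<union> ({a, b} \<times> V \<union> V \<times> {a, b})"
    unfolding P_def P'_def V'_def by (auto simp: pairs_def)
  then have "card P \<le> card (P' \<union> ({a, b} \<times> V \<union> V \<times> {a, b}))"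
    using fin V(1) by (intro card_mono) auto
  also have "\<dots> \<le> card P' + (2 * card V + card V * 2)"
    using card_Un_le[of P' "{a, b} \<times> V \<union> V \<times> {a, b}"] card_Un_le[of "{a, b} \<times> V" "V \<times> {a, b}"]
      abK(4) by (simp add: card_cartesian_product)
  finally have "d \<le> real (card P') + 4 * n"
    unfolding defs by simp
  \<comment> \<open>The hypothesis \<open>8 * card V \<le> card P\<close> makes the 4n ordered pairs
    meeting \<open>{a, b}\<close> at most half of \<open>P\<close>.\<close>
  then have 5: "d / 2 \<le> real (card P')"
    using d(1) unfolding defs by linarith
  have n: "200 \<le> n"
    using V(2) unfolding defs by simp
  have d': "16 * d \<le> 11 * (n * (n - 1))"
  proof -
    have "real (16 * card P) \<le> real (11 * (card V * (card V - 1)))"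
      using d(2) by (rule of_nat_mono)
    then show ?thesis
      unfolding defs using V(2) by (simp add: of_nat_diff)
  qed
  have "card V' = card V - 2"
    unfolding V'_def using abK V by (simp add: card_Diff_subset)
  then have "real (card (pairs V')) = (n - 2) * (n - 3)"
    unfolding card_pairs[OF fin(1)] defs using V(2) by (simp add: of_nat_diff)
  moreover have "card (pairs V') = card P' + card N'"
    unfolding P'_def N'_def using finite_pairs[OF fin(1)]
    by (subst card_Un_disjoint[symmetric]) (auto intro: rev_finite_subset intro!: arg_cong[of _ _ card])
  moreover have "card P' \<le> card P"
    unfolding P'_def P_def V'_def using finite_pairs[OF V(1)]
    by (intro card_mono) (auto simp: pairs_def intro: rev_finite_subset)
  ultimately have 6: "(n - 2) * (n - 3) - d \<le> \<nu>"
    unfolding defs by simp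
  have nonneg: "0 \<le> \<alpha>" "0 \<le> \<beta>" "0 \<le> \<mu>" "0 \<le> \<epsilon>" and le: "\<alpha> \<le> n"
    unfolding defs using V(1) by (auto simp: A_def V'_def intro!: card_mono)
  have "d / 2 \<le> \<epsilon> + \<alpha> * \<alpha>"
    using 1 5 by linarith
  then have \<alpha>: "200 * \<epsilon> < \<alpha> * \<alpha>"
    using eps nonneg by linarith
  \<comment> \<open>Since \<open>A \<times> M\<close> consists of bad pairs and \<open>A\<close> is
    large, cancelling \<open>\<alpha>\<close> shows that \<open>M\<close> is small.\<close>
  have "\<alpha> * (200 * \<mu>) < \<alpha> * \<alpha>"
    using 2 \<alpha> by linarith
  then have \<mu>: "200 * \<mu> < n"
    using nonneg(1) le by (auto simp: mult_less_cancel_left)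
  have \<epsilon>: "800 * \<epsilon> \<le> n * n"
  proof -
    have "n * (n - 1) \<le> n * n"
      using n by (simp add: algebra_simps)
    then show ?thesis
      using eps d' by (smt (verit) n zero_le_mult_iff)
  qed
  \<comment> \<open>All pairs in \<open>B\<close> are bad, so \<open>\<beta>\<close> above n/10
    would give about n^2/100 bad pairs against at most n^2/800.\<close>
  have \<beta>: "10 * \<beta> \<le> n"
  proof (rule ccontr)
    assume "\<not> ?thesis"
    then have "(n / 10) * (n / 10 - 1) \<le> \<beta> * (\<beta> - 1)"
      using n by (intro mult_mono) auto
    moreover have "200 * n \<le> n * n"
      using n by (intro mult_right_mono) auto
    moreover have "(n / 10) * (n / 10 - 1) = n * n / 100 - n / 10"
      by (simp add: field_simps)
    ultimately show False
      using 3 \<epsilon> n by linarith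
  qed
  have "\<alpha> * \<beta> \<le> n * (n / 10)"
    by (rule mult_mono) (use nonneg le \<beta> n in linarith)+
  moreover have "\<mu> * \<mu> \<le> (n / 200) * (n / 200)"
    by (rule mult_mono) (use nonneg \<mu> n in linarith)+
  moreover define q where "q = n * n"
  ultimately have "\<nu> \<le> q / 800 + q / 5 + q / 40000"
    using 4 \<epsilon> by (simp add: algebra_simps)
  moreover have "200 * n \<le> q"
    unfolding q_def using n by (intro mult_right_mono) auto
  moreover have "(n - 2) * (n - 3) = q - 5 * n + 6" "n * (n - 1) = q - n"
    by (simp_all add: q_def algebra_simps)
  then have "q - 5 * n + 6 - d \<le> \<nu>" "16 * d \<le> 11 * (q - n)"
    using 6 d' by simp_all
  \<comment> \<open>Density at most 11/16 leaves nearly 5/16 of all ordered pairs as non-edges,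
    while the upper bound on \<open>\<nu>\<close> is only slightly above n^2/5;
    \<open>200 \<le> n\<close> takes care of the linear terms.\<close>
  then have "5 * q - 69 * n + 96 \<le> 16 * \<nu>"
    by (simp add: algebra_simps)
  ultimately show False
    using n by linarith
qed

text \<open>Every ordered edge \<open>ab\<close> has at least \<open>card P / 800\<close> bad pairs.
  Each such configuration gives a nonzero alternating sum at one of the quadruples
  \<open>(a, y, b, x)\<close> and \<open>(a, x, b, y)\<close>; both assignments are injective, which
  doubles 800 to 1600.\<close>

lemma sum_abs_alt_ge:
  fixes V :: "'a set" and K :: "'a set set"
  defines "w \<equiv> (\<lambda>e. of_bool (e \<in> K)) :: 'a set \<Rightarrow> real"
    and "P \<equiv> {(x, y) \<in> pairs V. {x, y} \<in> K}"
  assumes V: "finite V" "200 \<le> card V"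
    and d: "8 * card V \<le> card P" "16 * card P \<le> 11 * (card V * (card V - 1))"
  shows "(real (card P))\<^sup>2 \<le> 1600 * (\<Sum>(x, y, a, b)\<in>quads V. \<bar>alt w x y a b\<bar>)"
proof -
  define Bad where "Bad = (\<lambda>(a, b). {(x, y) \<in> pairs (V - {a, b}).
    alt w a y b x \<noteq> 0 \<or> alt w a x b y \<noteq> 0})"
  let ?h = "\<lambda>(x, y, a, b). \<bar>alt w x y a b\<bar>"
  let ?f = "\<lambda>((a, b), (x, y)). (a, y, b, x)" and ?g = "\<lambda>((a, b), (x, y)). (a, x, b, y)"
  have finP: "finite P"
    unfolding P_def by (rule finite_subset[OF _ finite_pairs[OF V(1)]]) auto
  have finB: "finite (Bad e)" for e
    unfolding Bad_def using finite_pairs[of "V - {fst e, snd e}"] V(1)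
    by (auto simp: case_prod_beta intro: rev_finite_subset)
  have le: "card P \<le> 800 * card (Bad e)" if "e \<in> P" for e
    using unbalanced_edge_pairs[OF V d[unfolded P_def]] that
    unfolding Bad_def w_def P_def by (cases e) simp
  have sub: "?f ` Sigma P Bad \<subseteq> quads V" "?g ` Sigma P Bad \<subseteq> quads V"
    unfolding P_def Bad_def quads_def pairs_def by auto
  have *: "sum (?h \<circ> f) (Sigma P Bad) \<le> sum ?h (quads V)"
    if "inj_on f (Sigma P Bad)" "f ` Sigma P Bad \<subseteq> quads V" for f
    unfolding sum.reindex[OF that(1), symmetric]
    using that(2) finite_quads[OF V(1)] by (intro sum_mono2) auto
  have int: "alt w x y a b \<noteq> 0 \<Longrightarrow> 1 \<le> \<bar>alt w x y a b\<bar>" for x y a b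
    by (auto simp: alt_def w_def of_bool_def split: if_splits)
  have "card P * card P = (\<Sum>e\<in>P. card P)"
    by simp
  also have "\<dots> \<le> (\<Sum>e\<in>P. 800 * card (Bad e))"
    by (intro sum_mono le)
  also have "\<dots> = 800 * card (Sigma P Bad)"
    using finP finB by (simp add: sum_distrib_left)
  finally have "(real (card P))\<^sup>2 \<le> 800 * real (card (Sigma P Bad))"
    unfolding power2_eq_square by (simp flip: of_nat_mult)
  moreover have "real (card (Sigma P Bad)) \<le> sum (?h \<circ> ?f) (Sigma P Bad) + sum (?h \<circ> ?g) (Sigma P Bad)"
  proof -
    have "1 \<le> (?h \<circ> ?f) t + (?h \<circ> ?g) t" if "t \<in> Sigma P Bad" for t
    proof -
      obtain a b x y where t: "t = ((a, b), (x, y))"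
        by (metis surj_pair)
      then have "alt w a y b x \<noteq> 0 \<or> alt w a x b y \<noteq> 0"
        using that unfolding Bad_def by auto
      then show ?thesis
        using int[of a y b x] int[of a x b y] by (auto simp: t)
    qed
    then have "(\<Sum>t\<in>Sigma P Bad. 1) \<le> (\<Sum>t\<in>Sigma P Bad. (?h \<circ> ?f) t + (?h \<circ> ?g) t)"
      by (rule sum_mono)
    then show ?thesis
      by (simp add: sum.distrib)
  qed
  moreover have "sum (?h \<circ> ?f) (Sigma P Bad) \<le> sum ?h (quads V)"
    by (intro * sub) (auto simp: inj_on_def)
  moreover have "sum (?h \<circ> ?g) (Sigma P Bad) \<le> sum ?h (quads V)"
    by (intro * sub) (auto simp: inj_on_def)
  ultimately show ?thesis
    by linarith
qed

text \<open>If \<open>x\<close> and \<open>y\<close> disagree at some third vertex, the vanishing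
  sums determine the whole graph up to the status of \<open>xy\<close>: a star at \<open>x\<close>,
  or the complete graph on \<open>V - {y}\<close>. With n vertices these have 2n - 2 and n(n - 3) +
  2 ordered edges, so divisibility by n forces n to divide 2.\<close>

lemma alt_zero_edge_count:
  fixes V :: "'a set" and K :: "'a set set"
  defines "w \<equiv> (\<lambda>e. of_bool (e \<in> K)) :: 'a set \<Rightarrow> real"
    and "P \<equiv> {(x, y) \<in> pairs V. {x, y} \<in> K}"
  assumes V: "finite V" "3 \<le> card V"
    and alt: "\<And>x y a b. (x, y, a, b) \<in> quads V \<Longrightarrow> alt w x y a b = 0"
    and dvd: "card V dvd card P"
  shows "P = {} \<or> P = pairs V"
proof (rule ccontr)
  assume neq: "\<not> ?thesis"
  have "\<exists>x\<in>V. \<exists>y\<in>V. \<exists>z\<in>V. x \<noteq> y \<and> x \<noteq> z \<and> y \<noteq> z \<and> {x, z} \<in> K \<and> {y, z} \<notin> K"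
  proof (rule ccontr)
    assume none: "\<not> ?thesis"
    \<comment> \<open>If no two vertices disagree at a third one, an edge at \<open>z\<close>
      spreads to all edges at \<open>z\<close>, and from there to all pairs.\<close>
    then have step: "{y, z} \<in> K" if "{x, z} \<in> K" "x \<in> V" "y \<in> V" "z \<in> V" "x \<noteq> z" "y \<noteq> z" for x y z
      using that by (cases "x = y") auto
    from neq obtain x z where xz: "{x, z} \<in> K" "x \<in> V" "z \<in> V" "x \<noteq> z"
      unfolding P_def pairs_def by auto
    have "{s, t} \<in> K" if "s \<in> V" "t \<in> V" "s \<noteq> t" for s t
    proof (cases "s = z")
      case True
      then show ?thesis
        using step[OF xz(1), of t] xz that by (simp add: insert_commute)
    next
      case False
      then have "{s, z} \<in> K"
        using step[OF xz(1), of s] xz that by simp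
      then show ?thesis
        using step[of z s t] False xz that by (simp add: insert_commute)
    qed
    then show False
      using neq unfolding P_def pairs_def by auto
  qed
  then obtain x y z where xyz: "x \<in> V" "y \<in> V" "z \<in> V" "x \<noteq> y" "x \<noteq> z" "y \<noteq> z"
    "{x, z} \<in> K" "{y, z} \<notin> K"
    by blast
  \<comment> \<open>The alternating sum at \<open>x, y, z, t\<close> carries the difference
    \<open>w {x, z} - w {y, z} = 1\<close> over from \<open>z\<close> to \<open>t\<close>, which
    fixes both values at \<open>t\<close>.\<close>
  have K: "{x, t} \<in> K" "{y, t} \<notin> K" if "t \<in> V" "t \<noteq> x" "t \<noteq> y" for t
  proof -
    have "{x, t} \<in> K \<and> {y, t} \<notin> K"
    proof (cases "t = z")
      case False
      then have "alt w x y z t = 0"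
        using xyz that by (intro alt) (auto simp: quads_def)
      then show ?thesis
        using xyz(7,8) by (auto simp: alt_def w_def of_bool_def split: if_splits)
    qed (use xyz in simp)
    then show "{x, t} \<in> K" "{y, t} \<notin> K"
      by auto
  qed
  \<comment> \<open>With these values, the alternating sum at \<open>x, s, y, t\<close> reduces to
    \<open>w {x, y} + w {s, t} - 1\<close>.\<close>
  have K': "{s, t} \<in> K \<longleftrightarrow> {x, y} \<notin> K" if "s \<in> V" "t \<in> V" "s \<noteq> t" "s \<notin> {x, y}" "t \<notin> {x, y}" for s t
  proof -
    have "alt w x s y t = 0"
      using xyz that by (intro alt) (auto simp: quads_def)
    then show ?thesis
      using K[of s] K[of t] that
      by (auto simp: alt_def w_def insert_commute of_bool_def split: if_splits)
  qed
  obtain m where m: "card V = Suc (Suc (Suc m))"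
    using V(2) by (metis numeral_3_eq_3 le_Suc_ex plus_nat.simps)
  have "card V dvd 2"
  proof (cases "{x, y} \<in> K")
    case True
    have Kx: "{x, t} \<in> K" if "t \<in> V" "t \<noteq> x" for t
      using K(1)[of t] True that by (cases "t = y") auto
    have "P = {x} \<times> (V - {x}) \<union> (V - {x}) \<times> {x}"
    proof (intro equalityI subsetI)
      fix e assume e: "e \<in> P"
      then obtain s t where st: "e = (s, t)" "s \<in> V" "t \<in> V" "s \<noteq> t" "{s, t} \<in> K"
        unfolding P_def pairs_def by auto
      then have "s = x \<or> t = x"
        using K(2)[of s] K(2)[of t] K'[of s t] True
        by (cases "s = y"; cases "t = y") (auto simp: insert_commute)
      then show "e \<in> {x} \<times> (V - {x}) \<union> (V - {x}) \<times> {x}"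
        using st by auto
    next
      fix e assume "e \<in> {x} \<times> (V - {x}) \<union> (V - {x}) \<times> {x}"
      then show "e \<in> P"
        using Kx xyz(1) unfolding P_def pairs_def by (auto simp: insert_commute[of _ x])
    qed
    moreover have "({x} \<times> (V - {x})) \<inter> ((V - {x}) \<times> {x}) = {}"
      by auto
    ultimately have "card P = card ({x} \<times> (V - {x})) + card ((V - {x}) \<times> {x})"
      using V(1) by (simp add: card_Un_disjoint)
    also have "\<dots> = 2 * (card V - 1)"
      using xyz(1) V(1) by (simp add: card_cartesian_product)
    finally have "card P + 2 = card V * 2"
      using m by simp
    then show ?thesis
      using dvd by (metis dvd_add_right_iff dvd_triv_left)
  next
    case False
    have "P = pairs (V - {y})"
    proof (intro equalityI subsetI)
      fix e assume e: "e \<in> P"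
      then obtain s t where st: "e = (s, t)" "s \<in> V" "t \<in> V" "s \<noteq> t" "{s, t} \<in> K"
        unfolding P_def pairs_def by auto
      then have "s \<noteq> y" "t \<noteq> y"
        using K(2)[of s] K(2)[of t] False
        by (cases "s = x"; cases "t = x"; auto simp: insert_commute)+
      then show "e \<in> pairs (V - {y})"
        using st unfolding pairs_def by auto
    next
      fix e assume "e \<in> pairs (V - {y})"
      then obtain s t where st: "e = (s, t)" "s \<in> V" "t \<in> V" "s \<noteq> t" "s \<noteq> y" "t \<noteq> y"
        unfolding pairs_def by auto
      then have "{s, t} \<in> K"
        using K(1)[of s] K(1)[of t] K'[of s t] False by (cases "s = x"; cases "t = x") (auto simp: insert_commute)
      then show "e \<in> P"
        using st unfolding P_def pairs_def by auto
    qed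
    then have "card P = (card V - 1) * (card V - 2)"
      using xyz(2) V(1) by (simp add: card_pairs numeral_2_eq_2)
    then have "card P = card V * m + 2"
      using m by simp
    then show ?thesis
      using dvd by (metis dvd_add_right_iff dvd_triv_left)
  qed
  then show False
    using V(2) dvd_imp_le[of "card V" 2] by simp
qed

section \<open>Greedy pairing of vertices with different neighbourhoods\<close>

subsection \<open>Switches in trees\<close>

text \<open>Pairs are removed one at a time: a removal lowers each count by at most 2, which matches
  lowering \<open>m\<close> by 1. The slack \<open>+ 1\<close> means that for the last pair it is
  enough that \<open>f\<close> is not constant.\<close>

lemma disjoint_pairs_distinguished:
  fixes f :: "'a \<Rightarrow> 'b"
  assumes "finite S" "\<And>k. 2 * m \<le> card {v \<in> S. f v \<noteq> k} + 1"
  shows "\<exists>J. finite J \<and> card J = m \<and> J \<subseteq> S \<times> S \<and> (\<forall>(u, v)\<in>J. f u \<noteq> f v) \<and>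
    (\<forall>(u, v)\<in>J. \<forall>(x, y)\<in>J. (u, v) \<noteq> (x, y) \<longrightarrow> {u, v} \<inter> {x, y} = {})"
  using assms
proof (induction m arbitrary: S)
  case 0
  show ?case
    by (intro exI[of _ "{}"]) simp
next
  case (Suc m)
  have "card {v \<in> S. f v \<noteq> k} > 0" for k
    using Suc.prems(2)[of k] by simp
  then have ne: "\<exists>v\<in>S. f v \<noteq> k" for k
    by (metis (mono_tags, lifting) card_gt_0_iff empty_iff mem_Collect_eq equals0I)
  then obtain u where u: "u \<in> S"
    by blast
  obtain v where v: "v \<in> S" "f v \<noteq> f u"
    using ne by blast
  have "\<exists>J. finite J \<and> card J = m \<and> J \<subseteq> (S - {u, v}) \<times> (S - {u, v}) \<and> (\<forall>(u, v)\<in>J. f u \<noteq> f v) \<and>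
    (\<forall>(u, v)\<in>J. \<forall>(x, y)\<in>J. (u, v) \<noteq> (x, y) \<longrightarrow> {u, v} \<inter> {x, y} = {})"
  proof (rule Suc.IH)
    fix k
    have "card {w \<in> S. f w \<noteq> k} \<le> card ({w \<in> S - {u, v}. f w \<noteq> k} \<union> {u, v})"
      using Suc.prems(1) by (intro card_mono) auto
    also have "\<dots> \<le> card {w \<in> S - {u, v}. f w \<noteq> k} + 2"
      using card_Un_le[of "{w \<in> S - {u, v}. f w \<noteq> k}" "{u, v}"] v by (simp add: card_insert_if split: if_splits)
    finally show "2 * m \<le> card {w \<in> S - {u, v}. f w \<noteq> k} + 1"
      using Suc.prems(2)[of k] by simp
  qed (use Suc.prems in simp)
  then obtain J where J: "finite J" "card J = m" "J \<subseteq> (S - {u, v}) \<times> (S - {u, v})"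
    "\<forall>(u, v)\<in>J. f u \<noteq> f v"
    "\<forall>(u, v)\<in>J. \<forall>(x, y)\<in>J. (u, v) \<noteq> (x, y) \<longrightarrow> {u, v} \<inter> {x, y} = {}"
    by (elim exE conjE)
  have "(u, v) \<notin> J"
    using J(3) by auto
  then have "card (insert (u, v) J) = Suc m"
    using J by simp
  moreover have "insert (u, v) J \<subseteq> S \<times> S"
    using J(3) u v by auto
  moreover have "\<forall>(u, v)\<in>insert (u, v) J. f u \<noteq> f v"
    using J(4) v by auto
  moreover have "{a, b} \<inter> {x, y} = {}"
    if "(a, b) \<in> insert (u, v) J" "(x, y) \<in> insert (u, v) J" "(a, b) \<noteq> (x, y)" for a b x y
  proof (cases "(a, b) \<in> J \<and> (x, y) \<in> J")
    case True
    then show ?thesis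
      using J(5) that(3) by fastforce
  next
    case False
    then have "(a, b) = (u, v) \<and> (x, y) \<in> J \<or> (x, y) = (u, v) \<and> (a, b) \<in> J"
      using that by auto
    then show ?thesis
      using J(3) by auto
  qed
  then have "\<forall>(a, b)\<in>insert (u, v) J. \<forall>(x, y)\<in>insert (u, v) J.
      (a, b) \<noteq> (x, y) \<longrightarrow> {a, b} \<inter> {x, y} = {}"
    by blast
  ultimately show ?case
    using J(1) by (intro exI[of _ "insert (u, v) J"] conjI) simp_all
qed

section \<open>Basic facts about trees\<close>

locale tree =
  fixes T :: "'a ugraph"
  assumes tree: "tree_graph T"
begin

abbreviation V :: "'a set" where "V \<equiv> vertices T"
abbreviation E :: "'a set set" where "E \<equiv> edges T"
abbreviation N :: "'a \<Rightarrow> 'a set" where "N \<equiv> neighbours E"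

lemma finite_V: "finite V" and E_subset: "E \<subseteq> [V]\<^bsup>2\<^esup>" and V_nonempty: "V \<noteq> {}"
  using tree by (auto simp: tree_graph_def simple_graph_def connected_graph_def)

lemma finite_E: "finite E"
  by (rule finite_subset[OF E_subset finite_imp_finite_nsets[OF finite_V]])

lemma edgeD: "{u, v} \<in> E \<Longrightarrow> u \<in> V \<and> v \<in> V \<and> u \<noteq> v"
  using subsetD[OF E_subset, of "{u, v}"] by simp

lemma neighbours_subset: "N v \<subseteq> V"
  using edgeD by (auto simp: neighbours_def)

lemma finite_neighbours: "finite (N v)"
  using finite_subset[OF neighbours_subset finite_V] .

lemma neighbours_sym: "u \<in> N v \<longleftrightarrow> v \<in> N u"
  by (simp add: neighbours_def insert_commute)

lemma not_self_neighbour: "v \<notin> N v"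
  using edgeD[of v v] by (auto simp: neighbours_def)

lemma card_neighbours: "card (N v) = vertex_degree T v"
proof -
  have "inj_on (\<lambda>u. {v, u}) (N v)"
    by (auto simp: inj_on_def doubleton_eq_iff)
  moreover have "(\<lambda>u. {v, u}) ` N v = {e \<in> E. v \<in> e}"
  proof (intro equalityI subsetI)
    fix e assume e: "e \<in> {e \<in> E. v \<in> e}"
    then have "e \<in> [V]\<^bsup>2\<^esup>"
      using E_subset by auto
    then obtain x y where xy: "e = {x, y}"
      by (rule nsets2_E)
    then show "e \<in> (\<lambda>u. {v, u}) ` N v"
      using e by (auto simp: neighbours_def insert_commute)
  qed (auto simp: neighbours_def)
  ultimately show ?thesis
    unfolding vertex_degree_def by (metis card_image)
qed

lemma no_cycle: "\<not> graph_cycle T vs"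
  using tree by (simp add: tree_graph_def)

text \<open>Two common neighbours would close a 4-cycle.\<close>

lemma common_neighbours:
  assumes "u \<noteq> v" "a \<in> N u \<inter> N v" "b \<in> N u \<inter> N v"
  shows "a = b"
proof (rule ccontr)
  assume "a \<noteq> b"
  have "graph_cycle T [u, a, v, b]"
    unfolding graph_cycle_def
  proof (intro conjI allI impI)
    show "distinct [u, a, v, b]"
      using assms \<open>a \<noteq> b\<close> not_self_neighbour by auto
    fix i assume "i < length [u, a, v, b]"
    then consider "i = 0" | "i = 1" | "i = 2" | "i = 3"
      by fastforce
    moreover have "{u, a} \<in> E" "{a, v} \<in> E" "{v, b} \<in> E" "{b, u} \<in> E"
      using assms(2,3) by (auto simp: neighbours_def insert_commute)
    moreover have "length [u, a, v, b] = 4"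
      by simp
    ultimately show "{[u, a, v, b] ! i, [u, a, v, b] ! ((i + 1) mod length [u, a, v, b])} \<in> E"
      unfolding \<open>length [u, a, v, b] = 4\<close> by cases simp_all
  qed simp
  then show False
    using no_cycle by blast
qed

text \<open>Connectedness in the form used below, by induction along a walk.\<close>

lemma closed_eq_vertices:
  assumes "A \<subseteq> V" "A \<noteq> {}" "\<And>x. x \<in> A \<Longrightarrow> N x \<subseteq> A"
  shows "A = V"
proof -
  obtain a where a: "a \<in> A"
    using assms(2) by blast
  have "v \<in> A" if "v \<in> V" for v
  proof -
    have "(a, v) \<in> {(x, y). {x, y} \<in> E}\<^sup>*"
      using tree a assms(1) that by (auto simp: tree_graph_def connected_graph_def)
    then show ?thesis
      using a assms(3) by (induction rule: rtrancl_induct) (auto simp: neighbours_def)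
  qed
  then show ?thesis
    using assms(1) by blast
qed

lemma neighbours_nonempty:
  assumes "2 \<le> card V" "v \<in> V"
  shows "N v \<noteq> {}"
proof
  assume "N v = {}"
  then have "{v} = V"
    using assms(2) by (intro closed_eq_vertices) auto
  then have "card V = card {v}"
    by (rule arg_cong[OF sym])
  then show False
    using assms(1) by simp
qed

text \<open>A vertex set is grown from a single vertex. As long as it is not \<open>V\<close>,
  connectedness supplies an edge leaving it, so each new vertex brings a new edge.\<close>

lemma card_vertices_le_edges: "card V \<le> card E + 1"
proof -
  have "\<exists>A. A \<subseteq> V \<and> card A = Suc k \<and> k \<le> card {e \<in> E. e \<subseteq> A}" if "Suc k \<le> card V" for k
    using that
  proof (induction k)
    case 0
    obtain v where "v \<in> V"
      using V_nonempty by blast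
    then show ?case
      by (intro exI[of _ "{v}"]) simp
  next
    case (Suc k)
    then obtain A where A: "A \<subseteq> V" "card A = Suc k" "k \<le> card {e \<in> E. e \<subseteq> A}"
      by auto
    then have "A \<noteq> {}" "A \<noteq> V"
      using Suc.prems by auto
    then obtain x y where xy: "x \<in> A" "{x, y} \<in> E" "y \<notin> A"
      using closed_eq_vertices[OF A(1)] unfolding neighbours_def by blast
    have fin: "finite A" "finite {e \<in> E. e \<subseteq> A}"
      using A(1) finite_V finite_E finite_subset by auto
    have "insert {x, y} {e \<in> E. e \<subseteq> A} \<subseteq> {e \<in> E. e \<subseteq> insert y A}"
      using xy by auto
    then have "card (insert {x, y} {e \<in> E. e \<subseteq> A}) \<le> card {e \<in> E. e \<subseteq> insert y A}"
      using finite_E by (intro card_mono) auto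
    then have "Suc k \<le> card {e \<in> E. e \<subseteq> insert y A}"
      using A(3) fin xy by simp
    moreover have "insert y A \<subseteq> V"
      using A(1) xy(2) edgeD by blast
    moreover have "card (insert y A) = Suc (Suc k)"
      using A(2) fin xy(3) by simp
    ultimately show ?case
      by blast
  qed
  from this[of "card V - 1"] obtain A where "card V - 1 \<le> card {e \<in> E. e \<subseteq> A}"
    using V_nonempty finite_V by (auto simp: card_gt_0_iff Suc_leI)
  also have "\<dots> \<le> card E"
    using finite_E by (intro card_mono) auto
  finally show ?thesis
    by simp
qed

text \<open>The first vertex of a longest path inside \<open>U\<close> works. A neighbour in
  \<open>U\<close> off the path would extend it, and one at index 2 or later would close a
  cycle.\<close>

lemma ex_vertex_few_neighbours:
  assumes U: "finite U" "U \<noteq> {}"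
  shows "\<exists>v\<in>U. card (N v \<inter> U) \<le> 1"
proof -
  define path where "path vs \<longleftrightarrow> vs \<noteq> [] \<and> distinct vs \<and> set vs \<subseteq> U \<and>
    (\<forall>i. Suc i < length vs \<longrightarrow> {vs ! i, vs ! Suc i} \<in> E)" for vs
  obtain u where "u \<in> U"
    using U by blast
  then have "path [u]"
    by (simp add: path_def)
  moreover have "length vs < Suc (card U)" if "path vs" for vs
    using that U(1) unfolding path_def by (metis card_mono distinct_card less_Suc_eq_le)
  ultimately obtain vs where vs: "path vs" and max: "\<And>ws. path ws \<Longrightarrow> length ws \<le> length vs"
    using ex_has_greatest_nat[of path "[u]" length "Suc (card U)"] by blast
  obtain v ws where v: "vs = v # ws"
    using vs by (cases vs) (auto simp: path_def)
  have "x = vs ! 1" if x: "x \<in> N v \<inter> U" for x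
  proof -
    have "x \<in> set vs"
    proof (rule ccontr)
      assume "x \<notin> set vs"
      then have "path (x # vs)"
        using vs x v unfolding path_def
        by (auto simp: neighbours_def insert_commute nth_Cons split: nat.splits)
      then show False
        using max by fastforce
    qed
    then obtain j where j: "j < length vs" "x = vs ! j"
      by (auto simp: in_set_conv_nth)
    have "j \<noteq> 0"
      using j x v not_self_neighbour[of v] by (cases j) auto
    moreover have "\<not> 2 \<le> j"
    proof
      assume "2 \<le> j"
      have "graph_cycle T (take (Suc j) vs)"
        unfolding graph_cycle_def
      proof (intro conjI allI impI)
        show "3 \<le> length (take (Suc j) vs)"
          using j \<open>2 \<le> j\<close> by simp
        show "distinct (take (Suc j) vs)"
          using vs by (simp add: path_def)
        fix i assume "i < length (take (Suc j) vs)"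
        then have i: "i < Suc j"
          by simp
        show "{take (Suc j) vs ! i, take (Suc j) vs ! ((i + 1) mod length (take (Suc j) vs))} \<in> E"
        proof (cases "i = j")
          \<comment> \<open>The closing edge of the cycle leads from \<open>x\<close>, at index
            \<open>j\<close>, back to the start \<open>v\<close>.\<close>
          case True
          have "take (Suc j) vs ! i = x"
            using True j(2) by (simp only: nth_take lessI)
          moreover have "length (take (Suc j) vs) = Suc j"
            using j(1) by simp
          then have "(i + 1) mod length (take (Suc j) vs) = 0"
            using True by simp
          moreover have "take (Suc j) vs ! 0 = v"
            by (simp add: v)
          ultimately show ?thesis
            using x by (simp add: neighbours_def insert_commute)
        next
          case False
          then show ?thesis
            using i j vs by (simp add: path_def)
        qed
      qed
      then show False
        using no_cycle by blast
    qed
    ultimately have "j = 1"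
      by simp
    then show ?thesis
      using j by simp
  qed
  then have "N v \<inter> U \<subseteq> {vs ! 1}"
    by blast
  then have "card (N v \<inter> U) \<le> card {vs ! 1}"
    by (rule card_mono[rotated]) simp
  then have "card (N v \<inter> U) \<le> 1"
    by simp
  moreover have "v \<in> U"
    using vs v by (simp add: path_def)
  ultimately show ?thesis
    by blast
qed

section \<open>Independent sets and large families of switches\<close>

definition independent :: "'a set \<Rightarrow> bool" where
  "independent S \<longleftrightarrow> S \<subseteq> V \<and> (\<forall>x\<in>S. \<forall>y\<in>S. {x, y} \<notin> E)"

text \<open>A vertex with at most one neighbour in \<open>U\<close> is taken and removed together
  with that neighbour, so each chosen vertex costs at most two.\<close>

lemma ex_independent_half:
  assumes "U \<subseteq> V"
  shows "\<exists>H. H \<subseteq> U \<and> card U \<le> 2 * card H \<and> independent H"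
  using finite_subset[OF assms finite_V] assms
proof (induction U rule: finite_psubset_induct)
  case (psubset U)
  show ?case
  proof (cases "U = {}")
    case True
    then show ?thesis
      by (auto simp: independent_def)
  next
    case False
    then obtain v where v: "v \<in> U" "card (N v \<inter> U) \<le> 1"
      using ex_vertex_few_neighbours psubset.hyps by blast
    let ?W = "insert v (N v \<inter> U)"
    have "U - ?W \<subset> U" "U - ?W \<subseteq> V"
      using v(1) psubset.prems by auto
    from psubset.IH[OF this] obtain H
      where H: "H \<subseteq> U - ?W" "card (U - ?W) \<le> 2 * card H" "independent H"
      by (elim exE conjE)
    have fin: "finite H" "finite ?W"
      using finite_subset[OF H(1)] psubset.hyps finite_neighbours by auto
    have "card ?W \<le> 2"
      using v(2) fin by (simp add: card_insert_if)
    then have "card U \<le> card (U - ?W) + 2"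
      using diff_card_le_card_Diff[OF fin(2), of U] by linarith
    moreover have "v \<notin> H"
      using H(1) by blast
    ultimately have "card U \<le> 2 * card (insert v H)"
      using H(2) fin(1) by simp
    moreover have "independent (insert v H)"
      using H(1,3) v(1) psubset.prems not_self_neighbour[of v]
      by (auto simp: independent_def neighbours_def insert_commute)
    moreover have "insert v H \<subseteq> U"
      using H(1) v(1) by blast
    ultimately show ?thesis
      by blast
  qed
qed

text \<open>Let \<open>a\<close> be adjacent to \<open>u\<close> but not to \<open>v\<close>, and
  \<open>b\<close> any neighbour of \<open>v\<close>. The two edges \<open>ua\<close> and
  \<open>vb\<close> contribute 2, and at most 1 is subtracted. The opposite case follows by
  exchanging \<open>u\<close> and \<open>v\<close>, which only flips the sign.\<close>

lemma nontrivial_pair: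
  assumes V2: "2 \<le> card V" and uv: "u \<in> V" "v \<in> V" "{u, v} \<notin> E" "N u \<noteq> N v"
  shows "\<exists>a b. (u, v, a, b) \<in> quads V \<and> alt (\<lambda>e. of_bool (e \<in> E) :: real) u v a b \<noteq> 0"
proof -
  let ?\<kappa> = "alt (\<lambda>e. of_bool (e \<in> E) :: real)"
  have one: "\<exists>a b. (u, v, a, b) \<in> quads V \<and> ?\<kappa> u v a b \<noteq> 0"
    if uv: "u \<in> V" "v \<in> V" "{u, v} \<notin> E" and a: "a \<in> N u" "a \<notin> N v" for u v a
  proof -
    obtain b where b: "b \<in> N v"
      using neighbours_nonempty[OF V2 uv(2)] by blast
    have "(u, v, a, b) \<in> quads V"
      using uv a b edgeD[of u a] edgeD[of v b]
      by (auto simp: quads_def neighbours_def insert_commute)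
    moreover have "?\<kappa> u v a b \<noteq> 0"
      using a b by (auto simp: alt_def neighbours_def of_bool_def)
    ultimately show ?thesis
      by blast
  qed
  consider a where "a \<in> N u" "a \<notin> N v" | a where "a \<in> N v" "a \<notin> N u"
    using uv(4) by blast
  then show ?thesis
  proof cases
    case 1
    then show ?thesis
      using one uv by blast
  next
    case 2
    moreover have "{v, u} \<notin> E"
      using uv(3) by (simp add: insert_commute)
    ultimately obtain a b where "(v, u, a, b) \<in> quads V" "?\<kappa> v u a b \<noteq> 0"
      using one[OF uv(2,1)] by blast
    then have "(u, v, a, b) \<in> quads V" "?\<kappa> u v a b \<noteq> 0"
      by (auto simp: quads_def alt_def)
    then show ?thesis
      by blast
  qed
qed

text \<open>The hypotheses on \<open>J\<close> in \<open>switching_bound\<close>: disjoint pairs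
  with independent union, each having a nonzero alternating sum in the tree.\<close>

definition switch_family :: "('a \<times> 'a) set \<Rightarrow> bool" where
  "switch_family J \<longleftrightarrow> finite J \<and>
    (\<forall>u v x y. (u, v) \<in> J \<longrightarrow> (x, y) \<in> J \<longrightarrow> (u, v) \<noteq> (x, y) \<longrightarrow> {u, v} \<inter> {x, y} = {}) \<and>
    (\<forall>u v x y e. (u, v) \<in> J \<longrightarrow> (x, y) \<in> J \<longrightarrow> e \<in> E \<longrightarrow> \<not> e \<subseteq> {u, v, x, y}) \<and>
    (\<forall>u v. (u, v) \<in> J \<longrightarrow> (\<exists>a b. (u, v, a, b) \<in> quads V \<and>
      alt (\<lambda>e. of_bool (e \<in> E) :: real) u v a b \<noteq> 0))"

text \<open>Pairs with different neighbourhoods are chosen greedily; independence of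
  \<open>S\<close> makes their points nonadjacent, so \<open>nontrivial_pair\<close>
  applies.\<close>

lemma ex_switch_family_independent:
  assumes V2: "2 \<le> card V" and S: "independent S"
    and m: "\<And>k. 2 * m \<le> card {v \<in> S. N v \<noteq> k} + 1"
  shows "\<exists>J. switch_family J \<and> card J = m"
proof -
  have "S \<subseteq> V"
    using S by (simp add: independent_def)
  then have "finite S"
    using finite_V finite_subset by blast
  from disjoint_pairs_distinguished[OF this m] obtain J where J: "finite J" "card J = m" "J \<subseteq> S \<times> S"
    "\<forall>(u, v)\<in>J. N u \<noteq> N v"
    "\<forall>(u, v)\<in>J. \<forall>(x, y)\<in>J. (u, v) \<noteq> (x, y) \<longrightarrow> {u, v} \<inter> {x, y} = {}"
    by (elim exE conjE)
  have indep: "\<not> e \<subseteq> {u, v, x, y}" if e: "(u, v) \<in> J" "(x, y) \<in> J" "e \<in> E" for u v x y e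
  proof
    assume "e \<subseteq> {u, v, x, y}"
    then have "e \<subseteq> S"
      using e J(3) by blast
    moreover have "e \<in> [V]\<^bsup>2\<^esup>"
      using e(3) E_subset by blast
    then obtain s t where "e = {s, t}"
      by (rule nsets2_E)
    ultimately show False
      using S e(3) by (simp add: independent_def)
  qed
  have nontrivial: "\<exists>a b. (u, v, a, b) \<in> quads V \<and> alt (\<lambda>e. of_bool (e \<in> E) :: real) u v a b \<noteq> 0"
    if "(u, v) \<in> J" for u v
    using that J(3,4) S by (intro nontrivial_pair[OF V2]) (auto simp: independent_def)
  have disj: "{u, v} \<inter> {x, y} = {}" if "(u, v) \<in> J" "(x, y) \<in> J" "(u, v) \<noteq> (x, y)" for u v x y
  proof -
    have "\<forall>(x, y)\<in>J. (u, v) \<noteq> (x, y) \<longrightarrow> {u, v} \<inter> {x, y} = {}"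
      using bspec[OF J(5) that(1)] by (simp only: prod.case)
    from bspec[OF this that(2)] that(3) show ?thesis
      by (simp only: prod.case simp_thms)
  qed
  have "switch_family J"
    unfolding switch_family_def
    by (intro conjI allI impI)
      (rule J(1), (rule disj; assumption), (rule indep; assumption), (rule nontrivial; assumption))
  then show ?thesis
    using J(2) by blast
qed

lemma vertex_degree_le: "v \<in> V \<Longrightarrow> card (N v) \<le> max_degree T"
  unfolding card_neighbours max_degree_def using finite_V by (intro Max_ge) auto

lemma ex_max_degree: "\<exists>w\<in>V. card (N w) = max_degree T"
proof -
  have "max_degree T \<in> vertex_degree T ` V"
    unfolding max_degree_def using finite_V V_nonempty by (intro Max_in) auto
  then show ?thesis
    unfolding card_neighbours by force
qed

lemma card_non_neighbours:
  assumes "w \<in> V"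
  shows "card V \<le> card {v \<in> V. v \<noteq> w \<and> {v, w} \<notin> E} + 1 + max_degree T"
proof -
  have "V \<subseteq> {v \<in> V. v \<noteq> w \<and> {v, w} \<notin> E} \<union> insert w (N w)"
    by (auto simp: neighbours_def insert_commute)
  then have "card V \<le> card ({v \<in> V. v \<noteq> w \<and> {v, w} \<notin> E} \<union> insert w (N w))"
    using finite_V finite_neighbours by (intro card_mono) auto
  also have "\<dots> \<le> card {v \<in> V. v \<noteq> w \<and> {v, w} \<notin> E} + card (insert w (N w))"
    by (rule card_Un_le)
  also have "card (insert w (N w)) = 1 + card (N w)"
    using not_self_neighbour finite_neighbours by simp
  finally show ?thesis
    using vertex_degree_le[OF assms] by linarith
qed

text \<open>A vertex \<open>w\<close> of maximum degree has a non-neighbour \<open>q\<close>. If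
  they had the same neighbourhood, it would be a single vertex \<open>b\<close>, so the maximum
  degree would be 1, although \<open>b\<close> is adjacent to both.\<close>

lemma ex_switch:
  assumes "max_degree T + 2 \<le> card V"
  shows "\<exists>J. switch_family J \<and> card J = 1"
proof -
  have V2: "2 \<le> card V"
    using assms by simp
  obtain w where w: "w \<in> V" "card (N w) = max_degree T"
    using ex_max_degree by blast
  then have "card {v \<in> V. v \<noteq> w \<and> {v, w} \<notin> E} \<noteq> 0"
    using card_non_neighbours[OF w(1)] assms by linarith
  then obtain q where q: "q \<in> V" "q \<noteq> w" "{q, w} \<notin> E"
    by (auto simp: card_eq_0_iff)
  have "N q \<noteq> N w"
  proof
    assume eq: "N q = N w"
    obtain b where b: "b \<in> N w"
      using neighbours_nonempty[OF V2 w(1)] by blast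
    have "N w = {b}"
      using common_neighbours[OF q(2)] eq b by blast
    then have "max_degree T = 1"
      using w(2) by simp
    have "{q, w} \<subseteq> N b"
      using b eq neighbours_sym by blast
    then have "card {q, w} \<le> card (N b)"
      by (rule card_mono[OF finite_neighbours])
    moreover have "b \<in> V"
      using b neighbours_subset by blast
    ultimately have "2 \<le> max_degree T"
      using q(2) vertex_degree_le[of b] by simp
    with \<open>max_degree T = 1\<close> show False
      by simp
  qed
  then have ne: "{v \<in> {q, w}. N v \<noteq> k} \<noteq> {}" for k
    by (cases "N q = k") auto
  have pos: "0 < card {v \<in> {q, w}. N v \<noteq> k}" for k
    unfolding card_gt_0_iff using ne by simp
  have "2 * 1 \<le> card {v \<in> {q, w}. N v \<noteq> k} + 1" for k
    using pos[of k] by linarith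
  moreover have "independent {q, w}"
    using q w edgeD[of q q] edgeD[of w w] by (auto simp: independent_def insert_commute)
  ultimately show ?thesis
    by (intro ex_switch_family_independent[OF V2])
qed

text \<open>Two adjacent leaves would be a whole component.\<close>

lemma independent_leaves:
  assumes "3 \<le> card V"
  shows "independent {v \<in> V. card (N v) = 1}"
  unfolding independent_def
proof (intro conjI ballI notI)
  fix u v assume u: "u \<in> {v \<in> V. card (N v) = 1}" and v: "v \<in> {v \<in> V. card (N v) = 1}"
    and e: "{u, v} \<in> E"
  then have "v \<in> N u" "u \<in> N v"
    by (auto simp: neighbours_def insert_commute)
  then have "N u = {v}" "N v = {u}"
    using u v by (auto simp: card_1_singleton_iff)
  then have "{u, v} = V"
    using u v by (intro closed_eq_vertices) auto
  then have "card V \<le> 2"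
    using card_insert_le_m1[of 2 "{v}" u] by simp
  then show False
    using assms by simp
qed auto

text \<open>If every vertex misses at least \<open>q / 2\<close> leaves, the leaves can be paired.
  Otherwise there are more than \<open>q / 2\<close> inner vertices; these have pairwise different
  neighbourhoods, since two vertices share at most one neighbour, and an independent half of them
  can be paired.\<close>

lemma ex_switch_family:
  assumes D: "max_degree T + 2 \<le> card V"
  shows "\<exists>J. switch_family J \<and> card V \<le> 16 * card J + 1 + max_degree T"
proof -
  define q where "q = card V - 1 - max_degree T"
  define leaf where "leaf v \<longleftrightarrow> card (N v) = 1" for v
  have V2: "2 \<le> card V"
    using D by simp
  have "\<exists>J. switch_family J \<and> q \<le> 16 * card J"
  proof (cases "q \<le> 16")
    case True
    then show ?thesis
      using ex_switch[OF D] by fastforce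
  next
    case False
    show ?thesis
    proof (cases "\<forall>w\<in>V. q \<le> 2 * card {v \<in> V. (v \<noteq> w \<and> {v, w} \<notin> E) \<and> leaf v}")
      case True
      have "2 * (q div 4) \<le> card {v \<in> {v \<in> V. leaf v}. N v \<noteq> k} + 1" for k
      proof -
        \<comment> \<open>Leaves have singleton neighbourhoods, so only \<open>k = {w}\<close> can
          occur among them; for any other \<open>k\<close> an arbitrary \<open>w\<close>
          serves.\<close>
        obtain w where w: "w \<in> V" "k = {w} \<or> (\<forall>x\<in>V. k \<noteq> {x})"
          using V_nonempty by blast
        have "card {v \<in> V. (v \<noteq> w \<and> {v, w} \<notin> E) \<and> leaf v} \<le> card {v \<in> {v \<in> V. leaf v}. N v \<noteq> k}"
        proof (intro card_mono subsetI)
          fix v assume v: "v \<in> {v \<in> V. (v \<noteq> w \<and> {v, w} \<notin> E) \<and> leaf v}"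
          then have "N v \<noteq> {w}"
            by (auto simp: neighbours_def)
          moreover obtain x where "N v = {x}" "x \<in> V"
            using v neighbours_subset[of v] by (auto simp: leaf_def card_1_singleton_iff)
          ultimately show "v \<in> {v \<in> {v \<in> V. leaf v}. N v \<noteq> k}"
            using v w(2) by auto
        qed (use finite_V in simp)
        then show ?thesis
          using True w(1) by fastforce
      qed
      moreover have "independent {v \<in> V. leaf v}"
        unfolding leaf_def using False by (intro independent_leaves) (simp add: q_def)
      ultimately obtain J where "switch_family J" "card J = q div 4"
        using ex_switch_family_independent[OF V2] by blast
      then show ?thesis
        using False by (intro exI[of _ J]) simp
    next
      case few: False
      then obtain w where w: "w \<in> V" "2 * card {v \<in> V. (v \<noteq> w \<and> {v, w} \<notin> E) \<and> leaf v} < q"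
        by (auto simp: not_le)
      have "{v \<in> V. v \<noteq> w \<and> {v, w} \<notin> E}
          \<subseteq> {v \<in> V. (v \<noteq> w \<and> {v, w} \<notin> E) \<and> leaf v} \<union> {v \<in> V. \<not> leaf v}"
        by blast
      then have "card {v \<in> V. v \<noteq> w \<and> {v, w} \<notin> E}
          \<le> card ({v \<in> V. (v \<noteq> w \<and> {v, w} \<notin> E) \<and> leaf v} \<union> {v \<in> V. \<not> leaf v})"
        using finite_V by (intro card_mono) auto
      also have "\<dots> \<le> card {v \<in> V. (v \<noteq> w \<and> {v, w} \<notin> E) \<and> leaf v} + card {v \<in> V. \<not> leaf v}"
        by (rule card_Un_le)
      \<comment> \<open>The vertex \<open>w\<close> has at least \<open>q\<close> non-neighbours,
        and fewer than half of \<open>q\<close> are leaves.\<close>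
      finally have "q < 2 * card {v \<in> V. \<not> leaf v}"
        using w(2) card_non_neighbours[OF w(1)] unfolding q_def by linarith
      moreover obtain H where H: "H \<subseteq> {v \<in> V. \<not> leaf v}"
        "card {v \<in> V. \<not> leaf v} \<le> 2 * card H" "independent H"
        using ex_independent_half[of "{v \<in> V. \<not> leaf v}"] by auto
      ultimately have qH: "q < 4 * card H"
        by linarith
      have finH: "finite H"
        using H(1) finite_V finite_subset by fastforce
      have inj: "u = v" if uv: "u \<in> H" "v \<in> H" "N u = N v" for u v
      proof (rule ccontr)
        assume "u \<noteq> v"
        obtain a where a: "a \<in> N u"
          using neighbours_nonempty[OF V2, of u] uv(1) H(1) by blast
        have "N u = {a}"
          using common_neighbours[OF \<open>u \<noteq> v\<close>] a uv(3) by blast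
        then show False
          using uv(1) H(1) by (auto simp: leaf_def)
      qed
      have H': "card H \<le> card {v \<in> H. N v \<noteq> k} + 1" for k
      proof -
        obtain h where "{v \<in> H. N v = k} \<subseteq> {h}"
          using inj by blast
        then have "card {v \<in> H. N v = k} \<le> 1"
          using card_mono[of "{h}"] by simp
        moreover have "card H \<le> card {v \<in> H. N v \<noteq> k} + card {v \<in> H. N v = k}"
          using card_Un_le[of "{v \<in> H. N v \<noteq> k}" "{v \<in> H. N v = k}"]
          by (simp add: Collect_disj_eq[symmetric] conj_disj_distribL[symmetric])
        ultimately show ?thesis
          by linarith
      qed
      have "2 * (card H div 2) \<le> card {v \<in> H. N v \<noteq> k} + 1" for k
        using H'[of k] by linarith
      then obtain J where "switch_family J" "card J = card H div 2"
        using ex_switch_family_independent[OF V2 H(3)] by blast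
      then show ?thesis
        using False qH by (intro exI[of _ J]) simp
    qed
  qed
  then show ?thesis
    unfolding q_def using D by fastforce
qed

end

section \<open>From switches to a biased copy: large and small vertex numbers\<close>

subsection \<open>Biased copies\<close>

lemma sum_of_bool_eq:
  "finite A \<Longrightarrow> x \<in> A \<Longrightarrow> (\<Sum>i\<in>A. of_bool (x = i) :: real) = 1"
  by (simp add: of_bool_def)

lemma sum_of_bool_pairs:
  assumes "finite V"
  shows "(\<Sum>(x, y)\<in>pairs V. of_bool ({x, y} \<in> K)) = real (card {(x, y) \<in> pairs V. {x, y} \<in> K})"
proof -
  have "{(x, y) \<in> pairs V. {x, y} \<in> K} = pairs V \<inter> {t. {fst t, snd t} \<in> K}"
    by auto
  then show ?thesis
    using finite_pairs[OF assms] by (simp add: case_prod_beta)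
qed

context tree
begin

text \<open>The indicator is written as membership in \<open>{e. col e = i}\<close> to match the set
  \<open>K\<close> of the lemmas on alternating sums.\<close>

definition colour_weight :: "('a set \<Rightarrow> nat) \<Rightarrow> nat \<Rightarrow> ('a \<Rightarrow> 'a) \<Rightarrow> real" where
  "colour_weight col i = weight (\<lambda>e. of_bool (e \<in> {e. col e = i})) E"

lemma colour_weight_eq_card: "colour_weight col i p = real (card {e \<in> E. col (p ` e) = i})"
  unfolding colour_weight_def weight_def using finite_E by (simp add: Int_def)

lemma sum_colour_weight:
  assumes "col \<in> [V]\<^bsup>2\<^esup> \<rightarrow> {1..r}" "p permutes V"
  shows "(\<Sum>i\<in>{1..r}. colour_weight col i p) = real (card E)"
proof -
  have "p ` e \<in> [V]\<^bsup>2\<^esup>" if "e \<in> E" for e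
  proof -
    have "e \<in> [V]\<^bsup>2\<^esup>"
      using that E_subset by blast
    then obtain x y where xy: "e = {x, y}" "x \<in> V" "y \<in> V" "x \<noteq> y"
      by (rule nsets2_E)
    then show ?thesis
      using permutes_in_image[OF assms(2)] inj_eq[OF permutes_inj[OF assms(2)]] by simp
  qed
  then have "(\<Sum>i\<in>{1..r}. of_bool (col (p ` e) = i)) = (1 :: real)" if "e \<in> E" for e
    using that assms(1) by (intro sum_of_bool_eq) (auto simp: Pi_iff)
  then have "(\<Sum>e\<in>E. \<Sum>i\<in>{1..r}. of_bool (col (p ` e) = i)) = (\<Sum>e\<in>E. 1 :: real)"
    by (rule sum.cong[OF refl])
  then show ?thesis
    unfolding colour_weight_def weight_def mem_Collect_eq by (subst sum.swap) simp
qed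

lemma colour_switching_bound:
  assumes "2 \<le> card V" "switch_family J" "\<And>p. p permutes V \<Longrightarrow> colour_weight col i p \<le> M"
  shows "real (card E) * real (card {(x, y) \<in> pairs V. {x, y} \<in> {e. col e = i}}) / real (card (pairs V))
    + real (card J) / 4 * ((\<Sum>(x, y, a, b)\<in>quads V. \<bar>alt (\<lambda>e. of_bool (e \<in> {e. col e = i})) x y a b\<bar>)
        / real (card (quads V))) \<le> M"
proof -
  show ?thesis
    unfolding sum_of_bool_pairs[OF finite_V, symmetric]
  proof (rule switching_bound[OF finite_V assms(1) E_subset])
    show "weight (\<lambda>e. of_bool (e \<in> {e. col e = i})) E p \<le> M" if "p permutes V" for p
      using assms(3)[OF that] by (simp only: colour_weight_def)
  qed (use assms(2) in \<open>unfold switch_family_def, blast+\<close>)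
qed

text \<open>For the densest colour, the mean alone suffices if the density exceeds 11/16, because
  \<open>r \<ge> 2\<close> makes the target only slightly more than (n - 1)/2. Otherwise
  \<open>sum_abs_alt_ge\<close> makes the mean alternating sum at least of order 1/r^2.\<close>

lemma colour_density_large:
  assumes n: "100 * r \<le> card V" and r: "2 \<le> r" and D: "max_degree T + 2 \<le> card V"
    and col: "col \<in> [V]\<^bsup>2\<^esup> \<rightarrow> {1..r}"
    and M: "\<And>i p. i \<in> {1..r} \<Longrightarrow> p permutes V \<Longrightarrow> colour_weight col i p \<le> M"
  shows "(real (card V) - 1) / real r
    + (real (card V) - 1 - real (max_degree T)) / (500000 * (real r)\<^sup>2) \<le> M"
proof -
  define P where "P i = {(x, y) \<in> pairs V. {x, y} \<in> {e. col e = i}}" for i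
  define n R q where defs: "n = real (card V)" "R = real r" "q = n - 1 - real (max_degree T)"
  have n200: "200 \<le> n" "100 * R \<le> n" and R2: "2 \<le> R" and q: "1 \<le> q" "q \<le> n - 1"
    unfolding defs using n r D by simp_all
  have cardp: "real (card (pairs V)) = n * (n - 1)"
    unfolding card_pairs[OF finite_V] defs using D by (simp add: of_nat_diff)
  have "\<exists>i\<in>{1..r}. n * (n - 1) \<le> R * real (card (P i))"
  proof (rule ccontr)
    assume "\<not> ?thesis"
    then have "R * real (card (P i)) < n * (n - 1)" if "i \<in> {1..r}" for i
      using that by (simp add: not_le)
    then have "(\<Sum>i\<in>{1..r}. R * real (card (P i))) < (\<Sum>i\<in>{1..r}. n * (n - 1))"
      using r by (intro sum_strict_mono) auto
    moreover have "(\<Sum>i\<in>{1..r}. card (P i)) = card (pairs V)"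
    proof -
      have "pairs V = (\<Union>i\<in>{1..r}. P i)"
        using col by (auto simp: P_def pairs_def Pi_iff)
      moreover have "card (\<Union>i\<in>{1..r}. P i) = (\<Sum>i\<in>{1..r}. card (P i))"
        using finite_pairs[OF finite_V]
        by (intro card_UN_disjoint) (auto simp: P_def intro: rev_finite_subset)
      ultimately show ?thesis
        by simp
    qed
    then have "(\<Sum>i\<in>{1..r}. R * real (card (P i))) = R * (n * (n - 1))"
      unfolding cardp[symmetric] by (simp flip: sum_distrib_left of_nat_sum)
    ultimately show False
      by (simp add: defs)
  qed
  then obtain i where i: "i \<in> {1..r}" "n * (n - 1) \<le> R * real (card (P i))"
    by blast
  define W where "W = real (card (P i))"
  define A where "A = (\<Sum>(x, y, a, b)\<in>quads V. \<bar>alt (\<lambda>e. of_bool (e \<in> {e. col e = i}) :: real) x y a b\<bar>)"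
  obtain J where J: "switch_family J" "card V \<le> 16 * card J + 1 + max_degree T"
    using ex_switch_family[OF D] by (elim exE conjE)
  have "2 \<le> card V"
    using D by simp
  from colour_switching_bound[OF this J(1) M[OF i(1)]]
  have bound: "real (card E) * W / (n * (n - 1)) + real (card J) / 4 * (A / real (card (quads V))) \<le> M"
    unfolding cardp W_def A_def P_def by simp
  have A0: "0 \<le> A"
    unfolding A_def by (intro sum_nonneg) auto
  have "real (card V) \<le> real (card E + 1)"
    using card_vertices_le_edges by (rule of_nat_mono)
  then have "(n - 1) * W \<le> real (card E) * W"
    unfolding W_def defs by (intro mult_right_mono) auto
  then have "(n - 1) * W / (n * (n - 1)) \<le> real (card E) * W / (n * (n - 1))"
    using n200 by (intro divide_right_mono) auto
  then have avg: "W / n \<le> real (card E) * W / (n * (n - 1))"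
    using n200 by simp
  show ?thesis
  proof (cases "11 * (n * (n - 1)) < 16 * W")
    case True
    have "11 / 16 * (n - 1) \<le> W / n"
      using True n200 by (simp add: field_simps)
    moreover have "0 \<le> real (card J) / 4 * (A / real (card (quads V)))"
      using A0 by simp
    ultimately have "11 / 16 * (n - 1) \<le> M"
      using bound avg by linarith
    have "(n - 1) / R + q / (500000 * R\<^sup>2) \<le> (n - 1) / 2 + (n - 1) / 500000"
    proof (rule add_mono)
      show "(n - 1) / R \<le> (n - 1) / 2"
        using R2 n200 by (intro divide_left_mono) auto
      show "q / (500000 * R\<^sup>2) \<le> (n - 1) / 500000"
        using q n200 R2 by (intro frac_le) (auto simp: one_le_power)
    qed
    also have "\<dots> \<le> 11 / 16 * (n - 1)"
      using n200 by simp
    also note \<open>11 / 16 * (n - 1) \<le> M\<close>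
    finally have "(n - 1) / R + q / (500000 * R\<^sup>2) \<le> M" .
    then show ?thesis
      unfolding defs .
  next
    case False
    have "n * (n - 1) / R \<le> W"
      using i(2) R2 unfolding W_def by (simp add: field_simps)
    \<comment> \<open>Here \<open>100 * r \<le> card V\<close> enters: the densest colour has at
      least n(n - 1)/r, hence at least 8n, ordered edges.\<close>
    moreover have "8 * n \<le> 100 * (n - 1)"
      using n200 by simp
    moreover have "100 * (n - 1) \<le> n * (n - 1) / R"
      using mult_right_mono[OF n200(2), of "n - 1"] n200 R2 by (simp add: field_simps)
    ultimately have "8 * n \<le> W"
      by linarith
    then have "real (8 * card V) \<le> real (card (P i))"
      unfolding W_def defs by simp
    then have dens1: "8 * card V \<le> card (P i)"
      by (simp only: of_nat_le_iff)
    have "real (16 * card (P i)) \<le> real (11 * (card V * (card V - 1)))"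
      using False D unfolding W_def defs by (simp add: of_nat_diff)
    then have dens2: "16 * card (P i) \<le> 11 * (card V * (card V - 1))"
      by (simp only: of_nat_le_iff)
    have "200 \<le> card V"
      using n r by simp
    then have WA: "W\<^sup>2 \<le> 1600 * A"
      using sum_abs_alt_ge[OF finite_V _ dens1[unfolded P_def] dens2[unfolded P_def]]
      unfolding W_def A_def P_def by simp
    have lowW: "n * (n - 1) / R \<le> W"
      by fact
    have "n * (n / 2) \<le> n * (n - 1)"
      using n200 by (intro mult_left_mono) auto
    then have "n\<^sup>2 / 2 / R \<le> n * (n - 1) / R"
      using R2 by (intro divide_right_mono) (auto simp: power2_eq_square)
    then have "n\<^sup>2 / 2 / R \<le> W"
      using lowW by linarith
    \<comment> \<open>Squaring \<open>W\<close> at least n^2/(2R) and dividing by 1600 explains the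
      constant 6400.\<close>
    then have "(n\<^sup>2 / 2 / R)\<^sup>2 \<le> W\<^sup>2"
      using R2 n200 by (intro power_mono) auto
    moreover have "(n\<^sup>2 / 2 / R)\<^sup>2 = 1600 * (n ^ 4 / (6400 * R\<^sup>2))"
      using R2 by (simp add: power2_eq_square power4_eq_xxxx field_simps)
    ultimately have lowA: "n ^ 4 / (6400 * R\<^sup>2) \<le> A"
      using WA by linarith
    have "real (card (quads V)) \<le> n ^ 4"
      unfolding defs using of_nat_mono[OF card_quads_le[OF finite_V], where 'a = real] by simp
    moreover have "0 < A"
      using n200 R2 by (intro less_le_trans[OF _ lowA] divide_pos_pos) auto
    then have "quads V \<noteq> {}"
      unfolding A_def by auto
    then have "0 < real (card (quads V))"
      using finite_quads[OF finite_V] by (simp add: card_gt_0_iff)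
    ultimately have "n ^ 4 / (6400 * R\<^sup>2) / n ^ 4 \<le> A / real (card (quads V))"
      using lowA A0 n200 R2 by (intro frac_le) auto
    then have "1 / (6400 * R\<^sup>2) \<le> A / real (card (quads V))"
      using n200 by simp
    moreover have "real (card V) \<le> real (16 * card J + 1 + max_degree T)"
      using J(2) by (rule of_nat_mono)
    then have "q / 64 \<le> real (card J) / 4"
      unfolding defs by simp
    \<comment> \<open>There are at least \<open>q / 16\<close> switches, each gaining a quarter of
      the mean alternating sum. The resulting 64 * 6400 = 409600 is below 500000.\<close>
    ultimately have "q / 64 * (1 / (6400 * R\<^sup>2)) \<le> real (card J) / 4 * (A / real (card (quads V)))"
      using q R2 by (intro mult_mono) auto
    moreover have "q / (500000 * R\<^sup>2) \<le> q / 64 * (1 / (6400 * R\<^sup>2))"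
      using q R2 by (simp add: field_simps)
    moreover have "(n - 1) / R \<le> W / n"
      using lowW n200 R2 by (simp add: field_simps)
    ultimately have "(n - 1) / R + q / (500000 * R\<^sup>2) \<le> M"
      using bound avg by linarith
    then show ?thesis
      unfolding defs .
  qed
qed

text \<open>Counts below n/r are at most (n - 1)/r by integrality, and as the colours share at least
  n - 1 edges, every embedding has exactly k = (n - 1)/r edges of each colour. No switch then gains
  anything, so colour 1 has only zero alternating sums, and its ordered edge count nk is divisible
  by n. By \<open>alt_zero_edge_count\<close> it is empty or complete, contradicting 0 < k < n -
  1.\<close>

lemma not_perfectly_balanced:
  assumes r: "2 \<le> r" and D: "max_degree T + 2 \<le> card V"
    and col: "col \<in> [V]\<^bsup>2\<^esup> \<rightarrow> {1..r}"
  shows "\<exists>i\<in>{1..r}. \<exists>p. p permutes V \<and> real (card V) / real r \<le> colour_weight col i p"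
proof (rule ccontr)
  assume none: "\<not> ?thesis"
  define n R where defs: "n = real (card V)" "R = real r"
  have n2: "2 \<le> n" and R2: "2 \<le> R"
    unfolding defs using D r by simp_all
  have le: "colour_weight col i p \<le> (n - 1) / R" if "i \<in> {1..r}" "p permutes V" for i p
  proof -
    have "colour_weight col i p < n / R"
      using none that unfolding defs by (meson not_le)
    then have "colour_weight col i p * R < n"
      using R2 by (simp add: field_simps)
    then have "real (card {e \<in> E. col (p ` e) = i} * r) < real (card V)"
      unfolding colour_weight_eq_card defs by simp
    then have "card {e \<in> E. col (p ` e) = i} * r < card V"
      by (simp only: of_nat_less_iff)
    then have "real (card {e \<in> E. col (p ` e) = i} * r + 1) \<le> real (card V)"
      by (intro of_nat_mono) simp
    then show ?thesis
      unfolding colour_weight_eq_card using R2 by (simp add: field_simps defs)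
  qed
  have cardE: "n - 1 \<le> real (card E)"
    using of_nat_mono[OF card_vertices_le_edges, where 'a = real] unfolding defs by simp
  have eq: "colour_weight col i p = (n - 1) / R \<and> real (card E) = n - 1"
    if i: "i \<in> {1..r}" and p: "p permutes V" for i p
  proof -
    have "real (card E) = (\<Sum>j\<in>{1..r}. colour_weight col j p)"
      by (rule sum_colour_weight[OF col p, symmetric])
    also have "\<dots> = colour_weight col i p + (\<Sum>j\<in>{1..r} - {i}. colour_weight col j p)"
      using i by (intro sum.remove) auto
    also have "(\<Sum>j\<in>{1..r} - {i}. colour_weight col j p) \<le> (\<Sum>j\<in>{1..r} - {i}. (n - 1) / R)"
      using p by (intro sum_mono le) auto
    also have "\<dots> = (R - 1) * ((n - 1) / R)"
      using i r by (simp add: of_nat_diff defs)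
    finally have "real (card E) \<le> colour_weight col i p + (R - 1) * ((n - 1) / R)"
      by simp
    moreover have "(R - 1) * ((n - 1) / R) = (n - 1) - (n - 1) / R"
      using R2 by (simp add: field_simps)
    ultimately show ?thesis
      using le[OF i p] cardE by linarith
  qed
  have one: "1 \<in> {1..r}"
    using r by simp
  define P where "P = {(x, y) \<in> pairs V. {x, y} \<in> {e. col e = 1}}"
  define k where "k = card {e \<in> E. col (id ` e) = 1}"
  have "real k = (n - 1) / R"
    using eq[OF one permutes_id] unfolding colour_weight_eq_card k_def by simp
  then have kR: "real k * R = n - 1"
    using R2 by (simp add: field_simps)
  have cE: "real (card E) = n - 1"
    using eq[OF one permutes_id] by simp
  have cardp: "real (card (pairs V)) = n * (n - 1)"
    unfolding card_pairs[OF finite_V] defs using D by (simp add: of_nat_diff)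
  \<comment> \<open>The mean weight of colour 1 is computed twice: from its density and from the
    constant value \<open>k\<close>.\<close>
  have W: "real (card P) = n * real k"
  proof -
    have "n * (n - 1) * (\<Sum>p | p permutes V. colour_weight col 1 p)
        = fact (card V) * (n - 1) * real (card P)"
      using sum_weight[OF finite_V E_subset, of "\<lambda>e. of_bool (e \<in> {e. col e = 1})"]
      unfolding cardp cE colour_weight_def P_def sum_of_bool_pairs[OF finite_V] by simp
    moreover have "(\<Sum>p | p permutes V. colour_weight col 1 p) = (\<Sum>p | p permutes V. real k)"
      using eq[OF one] \<open>real k = (n - 1) / R\<close> by (intro sum.cong) auto
    then have "(\<Sum>p | p permutes V. colour_weight col 1 p) = fact (card V) * real k"
      using card_permutations[OF refl finite_V] by simp
    ultimately have "(fact (card V) * (n - 1)) * (n * real k) = (fact (card V) * (n - 1)) * real (card P)"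
      by (simp only: mult_ac)
    then show ?thesis
      using n2 by simp
  qed
  obtain J where J: "switch_family J" "card V \<le> 16 * card J + 1 + max_degree T"
    using ex_switch_family[OF D] by (elim exE conjE)
  define A where "A = (\<Sum>(x, y, a, b)\<in>quads V. \<bar>alt (\<lambda>e. of_bool (e \<in> {e. col e = 1}) :: real) x y a b\<bar>)"
  have "2 \<le> card V"
    using D by simp
  from colour_switching_bound[OF this J(1) le[OF one]]
  have "(n - 1) * (n * real k) / (n * (n - 1)) + real (card J) / 4 * (A / real (card (quads V))) \<le> (n - 1) / R"
    unfolding cardp cE W[symmetric] P_def A_def by simp
  moreover have "(n - 1) * (n * real k) / (n * (n - 1)) = (n - 1) / R"
    using n2 \<open>real k = (n - 1) / R\<close> by simp
  \<comment> \<open>The mean already equals the upper bound, so nothing is left for the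
    switches.\<close>
  ultimately have "real (card J) / 4 * (A / real (card (quads V))) \<le> 0"
    by linarith
  moreover have "0 < real (card J)"
    using J(2) D by simp
  ultimately have "A / real (card (quads V)) \<le> 0"
    using mult_pos_pos[of "real (card J) / 4" "A / real (card (quads V))"] by linarith
  moreover have "0 \<le> A"
    unfolding A_def by (intro sum_nonneg) auto
  ultimately have "A = 0 \<or> card (quads V) = 0"
    by (auto simp: divide_le_0_iff)
  then have "A = 0"
    using finite_quads[OF finite_V] unfolding A_def by auto
  have zero: "alt (\<lambda>e. of_bool (e \<in> {e. col e = 1}) :: real) x y a b = 0"
    if "(x, y, a, b) \<in> quads V" for x y a b
  proof -
    have "\<forall>t\<in>quads V. (\<lambda>(x, y, a, b). \<bar>alt (\<lambda>e. of_bool (e \<in> {e. col e = 1}) :: real) x y a b\<bar>) t = 0"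
      using \<open>A = 0\<close> unfolding A_def
      by (subst (asm) sum_nonneg_eq_0_iff) (use finite_quads[OF finite_V] in auto)
    then show ?thesis
      using that by fastforce
  qed
  have dvd: "card V dvd card P"
  proof -
    have "real (card P) = real (card V * k)"
      unfolding W defs by simp
    then have "card P = card V * k"
      by (simp only: of_nat_eq_iff)
    then show ?thesis
      by simp
  qed
  have "k \<noteq> 0"
  proof
    assume "k = 0"
    then have "n - 1 = 0"
      using kR by simp
    then show False
      using n2 by simp
  qed
  \<comment> \<open>Two vertices are excluded because n - 1 = kR is at least 2.\<close>
  moreover have "3 \<le> card V"
  proof (rule ccontr)
    assume "\<not> 3 \<le> card V"
    then have "n \<le> 2"
      unfolding defs by simp
    moreover have "1 * R \<le> real k * R"
      using \<open>k \<noteq> 0\<close> R2 by (intro mult_right_mono) auto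
    ultimately show False
      using kR R2 by simp
  qed
  moreover have "P \<noteq> {}"
    using W \<open>k \<noteq> 0\<close> n2 by auto
  ultimately have "P = pairs V"
    using alt_zero_edge_count[OF finite_V _ zero dvd[unfolded P_def]] unfolding P_def by blast
  then have "n * (n - 1) = n * real k"
    using W cardp by simp
  then have "n - 1 = real k"
    using n2 by simp
  then have "real k * R = real k * 1"
    using kR by simp
  then show False
    using \<open>k \<noteq> 0\<close> R2 by simp
qed

text \<open>If the maximum degree is at least n - 1, the correction is not positive and pigeonhole
  on a single embedding suffices. For n < 100r the gain 1/r is enough, since \<open>q\<close> is at
  most 100r. For larger n the switching bound applies.\<close>

lemma ex_biased_permutation:
  assumes r: "2 \<le> r" and col: "col \<in> [V]\<^bsup>2\<^esup> \<rightarrow> {1..r}"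
  shows "\<exists>i\<in>{1..r}. \<exists>p. p permutes V \<and>
    (real (card V) - 1) / real r + 1 / 1000000 / (real r)\<^sup>2 * (real (card V) - 1 - real (max_degree T))
      \<le> colour_weight col i p"
proof -
  define n R q where defs: "n = real (card V)" "R = real r" "q = n - 1 - real (max_degree T)"
  have R2: "2 \<le> R"
    unfolding defs using r by simp
  consider "card V < max_degree T + 2" | "max_degree T + 2 \<le> card V" "card V < 100 * r"
    | "max_degree T + 2 \<le> card V" "100 * r \<le> card V"
    by linarith
  then have "\<exists>i\<in>{1..r}. \<exists>p. p permutes V \<and> (n - 1) / R + 1 / 1000000 / R\<^sup>2 * q \<le> colour_weight col i p"
  proof cases
    case 1
    then have "q \<le> 0"
      unfolding defs by simp
    then have q: "1 / 1000000 / R\<^sup>2 * q \<le> 0"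
      by (simp add: divide_nonpos_nonneg)
    have "\<exists>i\<in>{1..r}. (n - 1) / R \<le> colour_weight col i id"
    proof (rule ccontr)
      assume "\<not> ?thesis"
      then have "(\<Sum>i\<in>{1..r}. colour_weight col i id) < (\<Sum>i\<in>{1..r}. (n - 1) / R)"
        using r by (intro sum_strict_mono) (auto simp: not_le)
      moreover have "(\<Sum>i\<in>{1..r}. colour_weight col i id) = real (card E)"
        by (rule sum_colour_weight[OF col permutes_id])
      ultimately have "real (card E) < n - 1"
        using R2 by (simp add: defs)
      then show False
        using of_nat_mono[OF card_vertices_le_edges, where 'a = real] unfolding defs by simp
    qed
    then obtain i where "i \<in> {1..r}" "(n - 1) / R \<le> colour_weight col i id"
      by blast
    then show ?thesis
      using q by (intro bexI[of _ i] exI[of _ id] conjI permutes_id) linarith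
  next
    case 2
    obtain i p where ip: "i \<in> {1..r}" "p permutes V" "n / R \<le> colour_weight col i p"
      using not_perfectly_balanced[OF r 2(1) col] unfolding defs by (elim bexE exE conjE)
    have "q \<le> 100 * R"
      using 2 unfolding defs by simp
    then have "1 / 1000000 / R\<^sup>2 * q \<le> 1 / 1000000 / R\<^sup>2 * (100 * R)"
      using R2 by (intro mult_left_mono) auto
    also have "\<dots> \<le> 1 / R"
      using R2 by (simp add: field_simps power2_eq_square)
    finally have "(n - 1) / R + 1 / 1000000 / R\<^sup>2 * q \<le> n / R"
      using R2 by (simp add: diff_divide_distrib)
    then show ?thesis
      using ip by (intro bexI[of _ i] exI[of _ p] conjI) simp_all
  next
    case 3
    have q: "1 \<le> q"
      using 3 unfolding defs by simp
    show ?thesis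
    proof (rule ccontr)
      assume "\<not> ?thesis"
      then have "colour_weight col i p \<le> (n - 1) / R + 1 / 1000000 / R\<^sup>2 * q"
        if "i \<in> {1..r}" "p permutes V" for i p
        using that by (meson less_imp_le not_le)
      \<comment> \<open>The failing target serves as the bound \<open>M\<close>, yet the guaranteed
        gain is twice the one in the target.\<close>
      from colour_density_large[OF 3(2) r 3(1) col this]
      have "q / (500000 * R\<^sup>2) \<le> 1 / 1000000 / R\<^sup>2 * q"
        unfolding defs by simp
      then show False
        using q R2 by (simp add: field_simps)
    qed
  qed
  then show ?thesis
    unfolding defs .
qed

lemma ex_copy:
  assumes f: "bij_betw f V {1..n}"
  shows "\<exists>H. is_copy H T (complete_graph n) \<and>
    card {e \<in> edges H. \<chi> e = i} = card {e \<in> E. \<chi> (f ` e) = i}"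
proof -
  define H where "H = \<lparr>vertices = {1..n}, edges = (`) f ` E\<rparr>"
  have inj: "inj_on f V" and im: "f ` V = {1..n}"
    using f by (auto simp: bij_betw_def)
  have E_Pow: "E \<subseteq> Pow V"
    using E_subset by (auto simp: nsets_def)
  have inj_image: "inj_on ((`) f) (Pow V)"
    using inj by (rule inj_on_image_Pow)
  have "f ` e \<in> [{1..n}]\<^bsup>2\<^esup>" if "e \<in> E" for e
  proof -
    have "e \<in> [V]\<^bsup>2\<^esup>"
      using that E_subset by blast
    then obtain x y where xy: "e = {x, y}" "x \<in> V" "y \<in> V" "x \<noteq> y"
      by (rule nsets2_E)
    then have "f x \<in> {1..n}" "f y \<in> {1..n}" "f x \<noteq> f y"
      using im inj by (auto dest: inj_onD)
    then show ?thesis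
      using xy(1) by simp
  qed
  then have "is_subgraph H (complete_graph n)"
    by (auto simp: is_subgraph_def simple_graph_def complete_graph_def H_def)
  moreover have "{u, v} \<in> E \<longleftrightarrow> {f u, f v} \<in> edges H" if "u \<in> V" "v \<in> V" for u v
  proof -
    have "f ` {u, v} \<in> (`) f ` E \<longleftrightarrow> {u, v} \<in> E"
      using that by (intro inj_on_image_mem_iff[OF inj_image _ E_Pow]) simp
    then show ?thesis
      by (simp add: H_def)
  qed
  then have "graph_isomorphic T H"
    unfolding graph_isomorphic_def using f by (intro exI[of _ f]) (simp add: H_def)
  moreover have "card {e \<in> edges H. \<chi> e = i} = card {e \<in> E. \<chi> (f ` e) = i}"
  proof -
    have "{e \<in> edges H. \<chi> e = i} = (`) f ` {e \<in> E. \<chi> (f ` e) = i}"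
      by (auto simp: H_def)
    moreover have "inj_on ((`) f) {e \<in> E. \<chi> (f ` e) = i}"
      using E_Pow by (intro inj_on_subset[OF inj_image]) auto
    ultimately show ?thesis
      by (simp only: card_image)
  qed
  ultimately show ?thesis
    unfolding is_copy_def by (intro exI[of _ H]) simp
qed

end

theorem theorem1p1:
  shows "\<exists>c::real. c > 0 \<and>
    (\<forall>(r::nat) (n::nat) (\<chi> :: nat set \<Rightarrow> nat).
       r \<ge> 2 \<longrightarrow> \<chi> \<in> edge_colourings (complete_graph n) r \<longrightarrow>
       (\<forall>T :: nat ugraph. tree_graph T \<longrightarrow> card (vertices T) = n \<longrightarrow>
          (\<exists>i \<in> {1..r}. \<exists>H. is_copy H T (complete_graph n) \<and>
             real (card {e \<in> edges H. \<chi> e = i})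
               \<ge> (real n - 1) / real r + c / (real r)\<^sup>2 * (real n - 1 - real (max_degree T)))))"
proof (intro exI[of _ "1 / 1000000"] conjI allI impI)
  fix r n :: nat and \<chi> :: "nat set \<Rightarrow> nat" and T :: "nat ugraph"
  assume r: "2 \<le> r" and \<chi>: "\<chi> \<in> edge_colourings (complete_graph n) r"
    and T: "tree_graph T" and n: "card (vertices T) = n"
  interpret tree T
    using T by unfold_locales
  obtain f where f: "bij_betw f V {1..n}"
    using finite_same_card_bij[OF finite_V, of "{1..n}"] n by auto
  \<comment> \<open>The colouring is pulled back along \<open>f\<close> to pairs of tree vertices,
    which turns embeddings into permutations of \<open>V\<close>.\<close>
  have "(\<lambda>e. \<chi> (f ` e)) \<in> [V]\<^bsup>2\<^esup> \<rightarrow> {1..r}"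
  proof
    fix e assume "e \<in> [V]\<^bsup>2\<^esup>"
    then obtain x y where xy: "e = {x, y}" "x \<in> V" "y \<in> V" "x \<noteq> y"
      by (rule nsets2_E)
    then have "f x \<in> {1..n}" "f y \<in> {1..n}" "f x \<noteq> f y"
      using f by (auto simp: bij_betw_def dest: inj_onD)
    then show "\<chi> (f ` e) \<in> {1..r}"
      using \<chi> xy(1) by (auto simp: edge_colourings_def complete_graph_def Pi_iff)
  qed
  from ex_biased_permutation[OF r this]
  obtain i p where i: "i \<in> {1..r}" and p: "p permutes V"
    and ge: "(real n - 1) / real r + 1 / 1000000 / (real r)\<^sup>2 * (real n - 1 - real (max_degree T))
      \<le> colour_weight (\<lambda>e. \<chi> (f ` e)) i p"
    unfolding n by (elim bexE exE conjE)
  have "bij_betw (f \<circ> p) V {1..n}"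
    using bij_betw_trans[OF permutes_imp_bij[OF p] f] .
  from ex_copy[OF this, of \<chi> i] obtain H where H: "is_copy H T (complete_graph n)"
    "card {e \<in> edges H. \<chi> e = i} = card {e \<in> E. \<chi> ((f \<circ> p) ` e) = i}"
    by (elim exE conjE)
  then have "real (card {e \<in> edges H. \<chi> e = i}) = colour_weight (\<lambda>e. \<chi> (f ` e)) i p"
    by (simp add: colour_weight_eq_card image_comp)
  then show "\<exists>i\<in>{1..r}. \<exists>H. is_copy H T (complete_graph n) \<and>
      (real n - 1) / real r + 1 / 1000000 / (real r)\<^sup>2 * (real n - 1 - real (max_degree T))
        \<le> real (card {e \<in> edges H. \<chi> e = i})"
    using i ge H(1) by (intro bexI[of _ i] exI[of _ H] conjI) simp_all
qed simp

end
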